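(* Let $(\mathcal A,I)$ be a hypergraph that satisfies the weak intersection property and is upper finitely covered. For any product functor $E$ on $\mathcal A$ and any commutative field $\mathbb K$, the Čech cohomology $H^\bullet(X_{\mathcal A};F)$ of the free sheaf $F$ generated by $E$ is naturally isomorphic to the direct sum of $H^\bullet(X_{\mathcal A};\overline F)$, which is concentrated in degree zero, and of the full Čech cohomology $H^\bullet(X_{\mathcal A};\mathbb K)$ (with constant coefficients $\mathbb K$) of the topological space $X_{\mathcal A}$.
   Context: Hypergraph: $I$ is a set and $\mathcal A$ is a set of finite subsets of $I$, viewed as a poset category with an arrow $\alpha\to\beta$ iff $\beta\subseteq\alpha$. Weak intersection property: $\alpha\cap\alpha'\in\mathcal A$ for all $\alpha,\alpha'\in\mathcal A$ with $\alpha\cap\alpha'\neq\emptyset$. Upper finitely covered: there is a finite subset $\mathcal B\subseteq\mathcal A$ such that every $\beta\in\mathcal A$ satisfies $\beta\to\alpha$ (i.e. $\alpha\subseteq\beta$) for some $\alpha\in\mathcal B$. Product functor: given non-empty sets $E_i$, $i\in I$, $E$ is the covariant functor on $\mathcal A$ with $E_\alpha=\prod_{i\in\alpha}E_i$ (a singleton if $\alpha=\emptyset$) and the (surjective) coordinate projections $\pi^{\beta\alpha}:E_\alpha\to E_\beta$ for $\beta\subseteq\alpha$. Free and restricted free sheaves: $F_\alpha=\mathbb K^{(E_\alpha)}$ is the vector space with basis $E_\alpha$, with maps $F_\alpha\to F_\beta$ induced by $\pi^{\beta\alpha}$ on bases; $\overline F_\alpha\subseteq F_\alpha$ is the subspace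 of vectors whose coordinates in the basis $E_\alpha$ sum to zero. These are covariant functors on $\mathcal A$. $X_{\mathcal A}$ is the set $\mathcal A$ with the lower Alexandrov topology, with basis $U_\alpha=\{\beta\in\mathcal A\mid\alpha\to\beta\}$; a covariant functor $G$ on $\mathcal A$ extends uniquely to a sheaf on $X_{\mathcal A}$, with value $\varprojlim_{\omega\in W}G_\omega$ on an open $W$. The constant coefficients $\mathbb K$ correspond to the constant functor on $\mathcal A$ with value $\mathbb K$. $H^n(X_{\mathcal A};-)$ is Čech cohomology (direct limit over open coverings ordered by refinement; cochains indexed by all finite sequences of members of the covering with non-empty intersection). *)

theory Defs
  imports "HOL-Analysis.Abstract_Topology" "HOL-Library.Function_Algebras"
    "HOL-Library.Poly_Mapping" "HOL-Library.FuncSet"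
begin

section \<open>Vector spaces with explicit carriers\<close>

text \<open>Cohomology spaces are carved out of types as subquotients, so a vector space over the
  field \<open>'k\<close> is passed around as a carrier together with its operations.\<close>

record ('k, 'a) vspace =
  vcarrier :: "'a set"
  vadd :: "'a \<Rightarrow> 'a \<Rightarrow> 'a"
  vzero :: "'a"
  vsmult :: "'k \<Rightarrow> 'a \<Rightarrow> 'a"

definition linear_iso :: "('a \<Rightarrow> 'b) \<Rightarrow> ('k, 'a) vspace \<Rightarrow> ('k, 'b) vspace \<Rightarrow> bool" where
  "linear_iso f V W \<longleftrightarrow>
     bij_betw f (vcarrier V) (vcarrier W) \<and>
     (\<forall>x\<in>vcarrier V. \<forall>y\<in>vcarrier V. f (vadd V x y) = vadd W (f x) (f y)) \<and>
     (\<forall>c. \<forall>x\<in>vcarrier V. f (vsmult V c x) = vsmult W c (f x))"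

definition direct_sum :: "('k, 'a) vspace \<Rightarrow> ('k, 'b) vspace \<Rightarrow> ('k, 'a \<times> 'b) vspace" where
  "direct_sum V W = \<lparr>
     vcarrier = vcarrier V \<times> vcarrier W,
     vadd = (\<lambda>(x, y) (x', y'). (vadd V x x', vadd W y y')),
     vzero = (vzero V, vzero W),
     vsmult = (\<lambda>c (x, y). (vsmult V c x, vsmult W c y)) \<rparr>"

definition coset :: "'a::ab_group_add set \<Rightarrow> 'a \<Rightarrow> 'a set" where
  "coset B z = (\<lambda>b. z + b) ` B"

text \<open>The quotient \<open>Z / B\<close> of a subspace \<open>Z\<close> of an ambient group \<open>'a\<close> with scalar
  multiplication \<open>sc\<close>.\<close>

definition quotient_space ::
  "('k \<Rightarrow> 'a \<Rightarrow> 'a) \<Rightarrow> 'a::ab_group_add set \<Rightarrow> 'a set \<Rightarrow> ('k, 'a set) vspace" where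
  "quotient_space sc Z B = \<lparr>
     vcarrier = coset B ` Z,
     vadd = (\<lambda>X Y. {x + y | x y. x \<in> X \<and> y \<in> Y}),
     vzero = B,
     vsmult = (\<lambda>c X. \<Union>x\<in>X. coset B (sc c x)) \<rparr>"

subsection \<open>Direct limits over a directed preordered set\<close>

definition dirlim_rel ::
  "'d set \<Rightarrow> ('d \<Rightarrow> 'd \<Rightarrow> bool) \<Rightarrow> ('d \<Rightarrow> ('k, 'a) vspace) \<Rightarrow> ('d \<Rightarrow> 'd \<Rightarrow> 'a \<Rightarrow> 'a)
     \<Rightarrow> (('d \<times> 'a) \<times> ('d \<times> 'a)) set" where
  "dirlim_rel D le V \<phi> = {((d, x), (d', x')).
     d \<in> D \<and> x \<in> vcarrier (V d) \<and> d' \<in> D \<and> x' \<in> vcarrier (V d') \<and>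
     (\<exists>d''\<in>D. le d d'' \<and> le d' d'' \<and> \<phi> d d'' x = \<phi> d' d'' x')}"

text \<open>Two classes always have representatives at a common index, by directedness; the sum is
  the class of the sum of such representatives.\<close>

definition direct_limit ::
  "'d set \<Rightarrow> ('d \<Rightarrow> 'd \<Rightarrow> bool) \<Rightarrow> ('d \<Rightarrow> ('k, 'a) vspace) \<Rightarrow> ('d \<Rightarrow> 'd \<Rightarrow> 'a \<Rightarrow> 'a)
     \<Rightarrow> ('k, ('d \<times> 'a) set) vspace" where
  "direct_limit D le V \<phi> = (let R = dirlim_rel D le V \<phi> in \<lparr>
     vcarrier = (SIGMA d:D. vcarrier (V d)) // R,
     vadd = (\<lambda>\<xi> \<zeta>. R `` {(d, vadd (V d) x y) | d x y. (d, x) \<in> \<xi> \<and> (d, y) \<in> \<zeta>}),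
     vzero = R `` {(d, vzero (V d)) | d. d \<in> D},
     vsmult = (\<lambda>c \<xi>. R `` {(d, vsmult (V d) c x) | d x. (d, x) \<in> \<xi>}) \<rparr>)"

section \<open>Cech cohomology of a presheaf of vector spaces\<close>

text \<open>\<open>restr P U V\<close> is the restriction from \<open>U\<close> to \<open>V \<subseteq> U\<close>. The sections over each open set
  form a subspace of the type \<open>'s\<close> with scalar multiplication \<open>pscale\<close>.\<close>

record ('a, 'k, 's) vpresheaf =
  sections :: "'a set \<Rightarrow> 's set"
  restr :: "'a set \<Rightarrow> 'a set \<Rightarrow> 's \<Rightarrow> 's"
  pscale :: "'k \<Rightarrow> 's \<Rightarrow> 's"

definition open_covering :: "'a topology \<Rightarrow> 'a set set \<Rightarrow> bool" where
  "open_covering X \<U> \<longleftrightarrow> (\<forall>U\<in>\<U>. openin X U) \<and> \<Union>\<U> = topspace X"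

definition refines :: "'a set set \<Rightarrow> 'a set set \<Rightarrow> bool" where
  "refines \<V> \<U> \<longleftrightarrow> (\<forall>V\<in>\<V>. \<exists>U\<in>\<U>. V \<subseteq> U)"

definition refinement_map :: "'a set set \<Rightarrow> 'a set set \<Rightarrow> ('a set \<Rightarrow> 'a set) \<Rightarrow> bool" where
  "refinement_map \<U> \<V> \<tau> \<longleftrightarrow> (\<forall>V\<in>\<V>. \<tau> V \<in> \<U> \<and> V \<subseteq> \<tau> V)"

definition simplices :: "'a set set \<Rightarrow> nat \<Rightarrow> 'a set list set" where
  "simplices \<U> n = {s. length s = Suc n \<and> set s \<subseteq> \<U> \<and> \<Inter>(set s) \<noteq> {}}"

definition cochains ::
  "('a, 'k, 's::ab_group_add) vpresheaf \<Rightarrow> 'a set set \<Rightarrow> nat \<Rightarrow> ('a set list \<Rightarrow> 's) set" where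
  "cochains P \<U> n = {c. (\<forall>s\<in>simplices \<U> n. c s \<in> sections P (\<Inter>(set s))) \<and>
                        (\<forall>s. s \<notin> simplices \<U> n \<longrightarrow> c s = 0)}"

definition omit :: "nat \<Rightarrow> 'b list \<Rightarrow> 'b list" where
  "omit j s = take j s @ drop (Suc j) s"

definition coboundary ::
  "('a, 'k, 's::ab_group_add) vpresheaf \<Rightarrow> 'a set set \<Rightarrow> nat
     \<Rightarrow> ('a set list \<Rightarrow> 's) \<Rightarrow> 'a set list \<Rightarrow> 's" where
  "coboundary P \<U> n c = (\<lambda>s. if s \<in> simplices \<U> (Suc n)
     then \<Sum>j\<le>Suc n. (let r = restr P (\<Inter>(set (omit j s))) (\<Inter>(set s)) (c (omit j s))
                       in if even j then r else - r)
     else 0)"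

definition cocycles ::
  "('a, 'k, 's::ab_group_add) vpresheaf \<Rightarrow> 'a set set \<Rightarrow> nat \<Rightarrow> ('a set list \<Rightarrow> 's) set" where
  "cocycles P \<U> n = {c \<in> cochains P \<U> n. coboundary P \<U> n c = 0}"

definition coboundaries ::
  "('a, 'k, 's::ab_group_add) vpresheaf \<Rightarrow> 'a set set \<Rightarrow> nat \<Rightarrow> ('a set list \<Rightarrow> 's) set" where
  "coboundaries P \<U> n = (case n of 0 \<Rightarrow> {0} | Suc m \<Rightarrow> coboundary P \<U> m ` cochains P \<U> m)"

definition cover_cohomology ::
  "('a, 'k, 's::ab_group_add) vpresheaf \<Rightarrow> nat \<Rightarrow> 'a set set
     \<Rightarrow> ('k, ('a set list \<Rightarrow> 's) set) vspace" where
  "cover_cohomology P n \<U> = quotient_space (\<lambda>k c s. pscale P k (c s))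
     (cocycles P \<U> n) (coboundaries P \<U> n)"

definition pull_cochain ::
  "('a, 'k, 's::ab_group_add) vpresheaf \<Rightarrow> 'a set set \<Rightarrow> nat \<Rightarrow> ('a set \<Rightarrow> 'a set)
     \<Rightarrow> ('a set list \<Rightarrow> 's) \<Rightarrow> 'a set list \<Rightarrow> 's" where
  "pull_cochain P \<V> n \<tau> c = (\<lambda>s. if s \<in> simplices \<V> n
     then restr P (\<Inter>(set (map \<tau> s))) (\<Inter>(set s)) (c (map \<tau> s)) else 0)"

text \<open>The class of the pulled back cocycle depends neither on the representative \<open>c\<close> of \<open>C\<close>
  nor on the refinement map \<open>\<tau>\<close>, so the union is over copies of one and the same coset.\<close>

definition refine_class ::
  "('a, 'k, 's::ab_group_add) vpresheaf \<Rightarrow> nat \<Rightarrow> 'a set set \<Rightarrow> 'a set set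
     \<Rightarrow> ('a set list \<Rightarrow> 's) set \<Rightarrow> ('a set list \<Rightarrow> 's) set" where
  "refine_class P n \<U> \<V> C =
     (\<Union>\<tau>\<in>{\<tau>. refinement_map \<U> \<V> \<tau>}. \<Union>c\<in>C. coset (coboundaries P \<V> n) (pull_cochain P \<V> n \<tau> c))"

type_synonym ('a, 's) cech_class = "('a set set \<times> ('a set list \<Rightarrow> 's) set) set"

definition cech_cohomology ::
  "'a topology \<Rightarrow> ('a, 'k, 's::ab_group_add) vpresheaf \<Rightarrow> nat \<Rightarrow> ('k, ('a, 's) cech_class) vspace" where
  "cech_cohomology X P n = direct_limit {\<U>. open_covering X \<U>} (\<lambda>\<U> \<V>. refines \<V> \<U>)
     (cover_cohomology P n) (refine_class P n)"

text \<open>The map in cohomology induced by a presheaf morphism \<open>h : P \<rightarrow> Q\<close>, where \<open>h W\<close> maps the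
  sections of \<open>P\<close> over \<open>W\<close> to those of \<open>Q\<close>.\<close>

definition cover_map ::
  "('a, 'k, 't::ab_group_add) vpresheaf \<Rightarrow> nat \<Rightarrow> ('a set \<Rightarrow> 's \<Rightarrow> 't) \<Rightarrow> 'a set set
     \<Rightarrow> ('a set list \<Rightarrow> 's::ab_group_add) set \<Rightarrow> ('a set list \<Rightarrow> 't) set" where
  "cover_map Q n h \<U> C = (\<Union>c\<in>C. coset (coboundaries Q \<U> n)
     (\<lambda>s. if s \<in> simplices \<U> n then h (\<Inter>(set s)) (c s) else 0))"

definition cech_map ::
  "'a topology \<Rightarrow> ('a, 'k, 't::ab_group_add) vpresheaf \<Rightarrow> nat \<Rightarrow> ('a set \<Rightarrow> 's::ab_group_add \<Rightarrow> 't)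
     \<Rightarrow> ('a, 's) cech_class \<Rightarrow> ('a, 't) cech_class" where
  "cech_map X Q n h \<xi> =
     dirlim_rel {\<U>. open_covering X \<U>} (\<lambda>\<U> \<V>. refines \<V> \<U>) (cover_cohomology Q n) (refine_class Q n)
       `` {(\<U>, cover_map Q n h \<U> C) | \<U> C. (\<U>, C) \<in> \<xi>}"

section \<open>Hypergraphs and their Alexandrov spaces\<close>

definition hypergraph :: "'i set \<Rightarrow> 'i set set \<Rightarrow> bool" where
  "hypergraph I \<A> \<longleftrightarrow> (\<forall>\<alpha>\<in>\<A>. \<alpha> \<subseteq> I \<and> finite \<alpha>)"

definition weak_intersection_property :: "'i set set \<Rightarrow> bool" where
  "weak_intersection_property \<A> \<longleftrightarrow> (\<forall>\<alpha>\<in>\<A>. \<forall>\<alpha>'\<in>\<A>. \<alpha> \<inter> \<alpha>' \<noteq> {} \<longrightarrow> \<alpha> \<inter> \<alpha>' \<in> \<A>)"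

definition upper_finitely_covered :: "'i set set \<Rightarrow> bool" where
  "upper_finitely_covered \<A> \<longleftrightarrow> (\<exists>\<B>\<subseteq>\<A>. finite \<B> \<and> (\<forall>\<beta>\<in>\<A>. \<exists>\<alpha>\<in>\<B>. \<alpha> \<subseteq> \<beta>))"

definition lower_set :: "'i set set \<Rightarrow> 'i set \<Rightarrow> 'i set set" where
  "lower_set \<A> \<alpha> = {\<beta> \<in> \<A>. \<beta> \<subseteq> \<alpha>}"

definition alexandrov :: "'i set set \<Rightarrow> 'i set topology" where
  "alexandrov \<A> = topology (arbitrary union_of (\<lambda>W. W \<in> lower_set \<A> ` \<A>))"

text \<open>A check that the sets \<open>lower_set \<A> \<alpha>\<close> do form a basis: the open sets are the down-closed
  subsets of \<open>\<A>\<close>.\<close>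

lemma openin_alexandrov:
  "openin (alexandrov \<A>) W \<longleftrightarrow> W \<subseteq> \<A> \<and> (\<forall>\<alpha>\<in>W. \<forall>\<beta>\<in>\<A>. \<beta> \<subseteq> \<alpha> \<longrightarrow> \<beta> \<in> W)"
proof -
  let ?P = "\<lambda>W. W \<subseteq> \<A> \<and> (\<forall>\<alpha>\<in>W. \<forall>\<beta>\<in>\<A>. \<beta> \<subseteq> \<alpha> \<longrightarrow> \<beta> \<in> W)"
  have eq: "(arbitrary union_of (\<lambda>W. W \<in> lower_set \<A> ` \<A>)) = ?P"
  proof (intro ext iffI)
    fix W assume "(arbitrary union_of (\<lambda>W. W \<in> lower_set \<A> ` \<A>)) W"
    then obtain \<W> where \<W>: "\<W> \<subseteq> lower_set \<A> ` \<A>" "\<Union>\<W> = W"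
      by (auto simp: union_of_def)
    show "?P W"
    proof (intro conjI ballI impI)
      show "W \<subseteq> \<A>"
        using \<W> by (auto simp: lower_set_def)
    next
      fix \<alpha> \<beta> assume "\<alpha> \<in> W" and \<beta>: "\<beta> \<in> \<A>" "\<beta> \<subseteq> \<alpha>"
      then obtain V where V: "V \<in> \<W>" "\<alpha> \<in> V" using \<W>(2) by blast
      then obtain \<gamma> where "V = lower_set \<A> \<gamma>" using \<W>(1) by blast
      then have "\<beta> \<in> V" using V(2) \<beta> by (auto simp: lower_set_def)
      then show "\<beta> \<in> W" using V(1) \<W>(2) by blast
    qed
  next
    fix W assume W: "?P W"
    have "W = \<Union>(lower_set \<A> ` W)"
      using W by (auto simp: lower_set_def)
    moreover have "lower_set \<A> ` W \<subseteq> Collect (\<lambda>W. W \<in> lower_set \<A> ` \<A>)"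
      using W by auto
    ultimately show "(arbitrary union_of (\<lambda>W. W \<in> lower_set \<A> ` \<A>)) W"
      unfolding union_of_def arbitrary_def by (intro exI[of _ "lower_set \<A> ` W"]) simp
  qed
  have "istopology ?P"
    unfolding istopology_def
  proof (intro conjI allI impI)
    fix S T assume "?P S" "?P T"
    then show "S \<inter> T \<subseteq> \<A>" "\<forall>\<alpha>\<in>S \<inter> T. \<forall>\<beta>\<in>\<A>. \<beta> \<subseteq> \<alpha> \<longrightarrow> \<beta> \<in> S \<inter> T"
      by auto
  next
    fix \<K> assume K: "\<forall>K\<in>\<K>. ?P K"
    show "\<Union>\<K> \<subseteq> \<A>" using K by auto
    show "\<forall>\<alpha>\<in>\<Union>\<K>. \<forall>\<beta>\<in>\<A>. \<beta> \<subseteq> \<alpha> \<longrightarrow> \<beta> \<in> \<Union>\<K>"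
    proof (intro ballI impI)
      fix \<alpha> \<beta> assume "\<alpha> \<in> \<Union>\<K>" and \<beta>: "\<beta> \<in> \<A>" "\<beta> \<subseteq> \<alpha>"
      then obtain S where "S \<in> \<K>" "\<alpha> \<in> S" by auto
      then show "\<beta> \<in> \<Union>\<K>" using K \<beta> by (intro UnionI[of S]) auto
    qed
  qed
  then show ?thesis
    by (simp add: alexandrov_def eq)
qed

section \<open>Functors on a hypergraph and the associated sheaves\<close>

text \<open>A covariant functor \<open>G\<close> to vector spaces: \<open>G\<^sub>\<alpha>\<close> is the subspace \<open>obj G \<alpha>\<close> of \<open>'v\<close>, with scalar
  multiplication \<open>fscale G\<close>, and \<open>mor G \<alpha> \<beta>\<close> is the map \<open>G\<^sub>\<alpha> \<rightarrow> G\<^sub>\<beta>\<close> for \<open>\<beta> \<subseteq> \<alpha>\<close>.\<close>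

record ('i, 'k, 'v) vfunctor =
  obj :: "'i set \<Rightarrow> 'v set"
  mor :: "'i set \<Rightarrow> 'i set \<Rightarrow> 'v \<Rightarrow> 'v"
  fscale :: "'k \<Rightarrow> 'v \<Rightarrow> 'v"

text \<open>The sections over \<open>W\<close> are the projective limit of \<open>G\<close> over \<open>W\<close>, with families extended by zero
  outside \<open>W\<close>.\<close>

definition sheaf_of ::
  "('i, 'k, 'v::ab_group_add) vfunctor \<Rightarrow> ('i set, 'k, 'i set \<Rightarrow> 'v) vpresheaf" where
  "sheaf_of G = \<lparr>
     sections = (\<lambda>W. {x. (\<forall>\<omega>\<in>W. x \<omega> \<in> obj G \<omega>) \<and> (\<forall>\<omega>. \<omega> \<notin> W \<longrightarrow> x \<omega> = 0) \<and>
                        (\<forall>\<alpha>\<in>W. \<forall>\<beta>\<in>W. \<beta> \<subseteq> \<alpha> \<longrightarrow> mor G \<alpha> \<beta> (x \<alpha>) = x \<beta>)}),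
     restr = (\<lambda>U V x \<omega>. if \<omega> \<in> V then x \<omega> else 0),
     pscale = (\<lambda>k x \<omega>. fscale G k (x \<omega>)) \<rparr>"

text \<open>\<open>cohom \<A> G n\<close> is \<open>H\<^sup>n(X\<^sub>\<A>; G)\<close>, and \<open>cohom_map \<A> G' n \<eta>\<close> is the map \<open>H\<^sup>n(X\<^sub>\<A>; G) \<rightarrow> H\<^sup>n(X\<^sub>\<A>; G')\<close>
  induced by the natural transformation \<open>\<eta> \<alpha> : G\<^sub>\<alpha> \<rightarrow> G'\<^sub>\<alpha>\<close>.\<close>

definition cohom ::
  "'i set set \<Rightarrow> ('i, 'k, 'v::ab_group_add) vfunctor \<Rightarrow> nat
     \<Rightarrow> ('k, ('i set, 'i set \<Rightarrow> 'v) cech_class) vspace" where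
  "cohom \<A> G n = cech_cohomology (alexandrov \<A>) (sheaf_of G) n"

definition cohom_map ::
  "'i set set \<Rightarrow> ('i, 'k, 'w::ab_group_add) vfunctor \<Rightarrow> nat \<Rightarrow> ('i set \<Rightarrow> 'v::ab_group_add \<Rightarrow> 'w)
     \<Rightarrow> ('i set, 'i set \<Rightarrow> 'v) cech_class \<Rightarrow> ('i set, 'i set \<Rightarrow> 'w) cech_class" where
  "cohom_map \<A> G' n \<eta> = cech_map (alexandrov \<A>) (sheaf_of G') n
     (\<lambda>W x \<omega>. if \<omega> \<in> W then \<eta> \<omega> (x \<omega>) else 0)"

section \<open>Product functors, free and restricted free sheaves\<close>

text \<open>The product functor of the family \<open>E\<close> is \<open>E\<^sub>\<alpha> = \<Pi>\<^sub>E i\<in>\<alpha>. E i\<close> with the coordinate projections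
  \<open>\<lambda>x. restrict x \<beta>\<close>.\<close>

definition product_functor :: "'i set \<Rightarrow> ('i \<Rightarrow> 'e set) \<Rightarrow> bool" where
  "product_functor I E \<longleftrightarrow> (\<forall>i\<in>I. E i \<noteq> {})"

definition coord_sum :: "('x \<Rightarrow>\<^sub>0 'k::field) \<Rightarrow> 'k" where
  "coord_sum v = (\<Sum>x\<in>Poly_Mapping.keys v. Poly_Mapping.lookup v x)"

definition push :: "('x \<Rightarrow> 'y) \<Rightarrow> ('x \<Rightarrow>\<^sub>0 'k::field) \<Rightarrow> ('y \<Rightarrow>\<^sub>0 'k)" where
  "push g v = (\<Sum>x\<in>Poly_Mapping.keys v. Poly_Mapping.single (g x) (Poly_Mapping.lookup v x))"

definition free_functor :: "('i \<Rightarrow> 'e set) \<Rightarrow> ('i, 'k::field, ('i \<Rightarrow> 'e) \<Rightarrow>\<^sub>0 'k) vfunctor" where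
  "free_functor E = \<lparr>
     obj = (\<lambda>\<alpha>. {v. Poly_Mapping.keys v \<subseteq> Pi\<^sub>E \<alpha> E}),
     mor = (\<lambda>\<alpha> \<beta>. push (\<lambda>x. restrict x \<beta>)),
     fscale = (\<lambda>k. Poly_Mapping.map ((*) k)) \<rparr>"

definition restricted_free_functor ::
  "('i \<Rightarrow> 'e set) \<Rightarrow> ('i, 'k::field, ('i \<Rightarrow> 'e) \<Rightarrow>\<^sub>0 'k) vfunctor" where
  "restricted_free_functor E = (free_functor E)
     \<lparr> obj := (\<lambda>\<alpha>. {v \<in> obj (free_functor E) \<alpha>. coord_sum v = 0}) \<rparr>"

definition constant_functor :: "('i, 'k::field, 'k) vfunctor" where
  "constant_functor = \<lparr> obj = (\<lambda>\<alpha>. UNIV), mor = (\<lambda>\<alpha> \<beta> x. x), fscale = (*) \<rparr>"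

lemma product_functor_iff_base_point: "product_functor I E \<longleftrightarrow> (\<exists>e. e \<in> Pi\<^sub>E I E)"
  unfolding product_functor_def by (metis PiE_eq_empty_iff all_not_in_conv)

text \<open>Natural transformations \<open>E \<rightarrow> E'\<close> of product functors carrying the base point \<open>e \<in> \<Pi>\<^sub>E i\<in>I. E i\<close> to
  the base point \<open>e'\<close>. A splitting of \<open>H(F) \<rightarrow> H(K)\<close> cannot be natural for maps not respecting a
  base point: already for \<open>\<A> = {{i}}\<close> and \<open>E i\<close> infinite no nonzero vector of the \<open>K\<close>-span of \<open>E i\<close> is
  fixed by all permutations of \<open>E i\<close>.\<close>

definition pointed_morphism ::
  "'i set set \<Rightarrow> ('i \<Rightarrow> 'e set) \<Rightarrow> ('i \<Rightarrow> 'e) \<Rightarrow> ('i \<Rightarrow> 'e set) \<Rightarrow> ('i \<Rightarrow> 'e)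
     \<Rightarrow> ('i set \<Rightarrow> ('i \<Rightarrow> 'e) \<Rightarrow> ('i \<Rightarrow> 'e)) \<Rightarrow> bool" where
  "pointed_morphism \<A> E e E' e' f \<longleftrightarrow>
     (\<forall>\<alpha>\<in>\<A>. \<forall>x\<in>Pi\<^sub>E \<alpha> E. f \<alpha> x \<in> Pi\<^sub>E \<alpha> E') \<and>
     (\<forall>\<alpha>\<in>\<A>. \<forall>\<beta>\<in>\<A>. \<beta> \<subseteq> \<alpha> \<longrightarrow> (\<forall>x\<in>Pi\<^sub>E \<alpha> E. restrict (f \<alpha> x) \<beta> = f \<beta> (restrict x \<beta>))) \<and>
     (\<forall>\<alpha>\<in>\<A>. f \<alpha> (restrict e \<alpha>) = restrict e' \<alpha>)"

end

theory Submission
  imports Defs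
begin

text \<open>A base point \<open>e\<close> gives a natural splitting \<open>F = F' \<oplus> K\<close> of functors, \<open>F'\<close> the restricted free functor, and
  \<open>H\<close> is an additive functor; this yields the direct sum decomposition. The minimal open sets form a covering
  refining all others, so the direct limit is attained there.

  For the vanishing, tensoring the decompositions \<open>K\<^bsup>(E i)\<^esup> = K e\<^sub>i \<oplus> N\<^sub>i\<close>, \<open>N\<^sub>i\<close> the vectors of
  coordinate sum zero, splits \<open>F'\<close> into summands indexed by the finite sets \<open>T \<noteq> {}\<close>, the summand of \<open>T\<close> being constant on \<open>{\<alpha>. T \<subseteq> \<alpha>}\<close> and zero elsewhere. Since sets of \<open>\<A>\<close>
  containing \<open>T\<close> intersect in \<open>\<A>\<close>, its Cech complex is that of a full simplex.\<close>

section \<open>Alternating sums over faces of lists\<close>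

text \<open>The summand of \<open>T\<close> is never formed as a functor. Let P_i replace coordinate
  i by the base point. The projection to the summand is the product of the 1 - P_i for i in
  \<open>T\<close> and the P_i for i outside \<open>T\<close>; expanding it gives an alternating sum
  over the subsets of \<open>T\<close>, and tensor products disappear. The obstacle is that \<A> may
  be infinite, so that a cochain may have infinitely many nonzero components. The contraction is
  therefore written at one point \<omega> at a time, as a finite sum, and the work lies in showing
  that it commutes with restrictions. The weak intersection property speaks only of sets that meet.
  Two edges containing a nonempty \<open>T\<close> do meet, whereas for \<open>T = {}\<close>
  nothing is known; the component at \<open>{}\<close> is exactly the coordinate sum. This is why
  the argument is made for the kernel of the coordinate sum.\<close>

primrec alt_sum :: "('b list \<Rightarrow> 'v::ab_group_add) \<Rightarrow> 'b list \<Rightarrow> 'v" where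
  "alt_sum g [] = 0"
| "alt_sum g (x # s) = g s - alt_sum (\<lambda>t. g (x # t)) s"

text \<open>For a list of entries x_0, .., x_n this is the classical prism operator, the sum over j
  of (-1)^j times \<open>g\<close> at the list \<tau> x_0, .., \<tau> x_j, \<tau>' x_j, .., \<tau>'
  x_n.\<close>

primrec prism :: "('b \<Rightarrow> 'c) \<Rightarrow> ('b \<Rightarrow> 'c) \<Rightarrow> ('c list \<Rightarrow> 'v::ab_group_add) \<Rightarrow> 'b list \<Rightarrow> 'v" where
  "prism \<tau> \<tau>' g [] = 0"
| "prism \<tau> \<tau>' g (x # s) = g (\<tau> x # \<tau>' x # map \<tau>' s) - prism \<tau> \<tau>' (\<lambda>t. g (\<tau> x # t)) s"

text \<open>The bridge to \<open>coboundary\<close>, whose faces are given by \<open>omit\<close>: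
  below a fixed head the positions shift by one, hence the sign in the recursion.\<close>

lemma alt_sum_eq_sum_omit:
  "alt_sum g s = (\<Sum>j<length s. if even j then g (omit j s) else - g (omit j s))"
proof (induction s arbitrary: g)
  case (Cons x s)
  have "(\<Sum>j<length (x # s). if even j then g (omit j (x # s)) else - g (omit j (x # s))) =
    g s + (\<Sum>j<length s. - (if even j then g (x # omit j s) else - g (x # omit j s)))"
    by (simp only: list.size add_Suc_right add_0_right sum.lessThan_Suc_shift)
      (auto simp: omit_def intro!: sum.cong)
  then show ?case
    by (simp add: Cons sum_negf)
qed simp

text \<open>Of a face only its length and its set of entries are retained, since being a simplex at
  a point depends on nothing else.\<close>

lemma alt_sum_cong:
  assumes "\<And>t. length s = Suc (length t) \<Longrightarrow> set t \<subseteq> set s \<Longrightarrow> g t = h t"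
  shows "alt_sum g s = alt_sum h s"
  using assms
proof (induction s arbitrary: g h)
  case (Cons x s)
  have "alt_sum (\<lambda>t. g (x # t)) s = alt_sum (\<lambda>t. h (x # t)) s"
    by (rule Cons.IH) (auto intro!: Cons.prems)
  moreover have "g s = h s"
    by (rule Cons.prems) auto
  ultimately show ?case by simp
qed simp

lemma prism_cong:
  assumes "\<And>t. length t = Suc (length s) \<Longrightarrow> set t \<subseteq> \<tau> ` set s \<union> \<tau>' ` set s \<Longrightarrow> g t = h t"
  shows "prism \<tau> \<tau>' g s = prism \<tau> \<tau>' h s"
  using assms
proof (induction s arbitrary: g h)
  case (Cons x s)
  have "prism \<tau> \<tau>' (\<lambda>t. g (\<tau> x # t)) s = prism \<tau> \<tau>' (\<lambda>t. h (\<tau> x # t)) s"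
    by (rule Cons.IH) (auto intro!: Cons.prems)
  moreover have "g (\<tau> x # \<tau>' x # map \<tau>' s) = h (\<tau> x # \<tau>' x # map \<tau>' s)"
    by (rule Cons.prems) auto
  ultimately show ?case by simp
qed simp

lemma alt_sum_zero [simp]: "alt_sum (\<lambda>t. 0) s = 0"
  by (induction s) auto

lemma prism_zero [simp]: "prism \<tau> \<tau>' (\<lambda>t. 0) s = 0"
  by (induction s) auto

lemma alt_sum_diff: "alt_sum (\<lambda>t. g t - h t) s = alt_sum g s - alt_sum h s"
  by (induction s arbitrary: g h) (auto simp: algebra_simps)

lemma prism_diff: "prism \<tau> \<tau>' (\<lambda>t. g t - h t) s = prism \<tau> \<tau>' g s - prism \<tau> \<tau>' h s"
  by (induction s arbitrary: g h) (auto simp: algebra_simps)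

lemma alt_sum_sum: "alt_sum (\<lambda>t. \<Sum>i\<in>I. g i t) s = (\<Sum>i\<in>I. alt_sum (g i) s)"
  by (induction s arbitrary: g) (auto simp: sum_subtractf)

lemma alt_sum_map: "alt_sum (\<lambda>t. g (map \<tau> t)) s = alt_sum g (map \<tau> s)"
proof (induction s arbitrary: g)
  case (Cons x s)
  show ?case
    using Cons[of "\<lambda>t. g (\<tau> x # t)"] by simp
qed simp

lemma (in additive) alt_sum: "f (alt_sum g s) = alt_sum (\<lambda>t. f (g t)) s"
  by (induction s arbitrary: g) (auto simp: zero diff)

lemma (in additive) prism: "f (prism \<tau> \<tau>' g s) = prism \<tau> \<tau>' (\<lambda>t. f (g t)) s"
  by (induction s arbitrary: g) (auto simp: zero diff)

text \<open>With the alternating sum over faces written as a recursion on the list, the chain homotopy between two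
  vertex maps needs no manipulation of double sums.\<close>

lemma prism_homotopy:
  "alt_sum (prism \<tau> \<tau>' g) s + prism \<tau> \<tau>' (alt_sum g) s = g (map \<tau>' s) - g (map \<tau> s)"
proof (induction s arbitrary: g)
  case (Cons x s)
  have 1: "alt_sum (\<lambda>t. prism \<tau> \<tau>' g (x # t)) s =
      alt_sum (\<lambda>t. g (\<tau> x # \<tau>' x # t)) (map \<tau>' s) - alt_sum (prism \<tau> \<tau>' (\<lambda>t. g (\<tau> x # t))) s"
    by (simp add: alt_sum_diff alt_sum_map[symmetric])
  have 2: "prism \<tau> \<tau>' (\<lambda>t. alt_sum g (\<tau> x # t)) s =
      prism \<tau> \<tau>' g s - prism \<tau> \<tau>' (alt_sum (\<lambda>t. g (\<tau> x # t))) s"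
    by (simp add: prism_diff)
  have 3: "alt_sum g (\<tau> x # \<tau>' x # map \<tau>' s) = g (\<tau>' x # map \<tau>' s) - g (\<tau> x # map \<tau>' s) +
      alt_sum (\<lambda>t. g (\<tau> x # \<tau>' x # t)) (map \<tau>' s)"
    by simp
  show ?case
    unfolding alt_sum.simps(2)[of "prism \<tau> \<tau>' g"] prism.simps(2)[of \<tau> \<tau>' "alt_sum g"] 1 2 3
    using Cons[of "\<lambda>t. g (\<tau> x # t)"] by (simp add: algebra_simps)
qed simp

text \<open>Homotopies involve signs only, so closure under differences is all they require; scalars
  enter separately in \<open>quotient_setup\<close>.\<close>

definition add_subgroup :: "'v::ab_group_add set \<Rightarrow> bool" where
  "add_subgroup S \<longleftrightarrow> 0 \<in> S \<and> (\<forall>x\<in>S. \<forall>y\<in>S. x - y \<in> S)"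

lemma add_subgroupD:
  assumes "add_subgroup S"
  shows "0 \<in> S" "x \<in> S \<Longrightarrow> y \<in> S \<Longrightarrow> x - y \<in> S" "x \<in> S \<Longrightarrow> - x \<in> S"
    "x \<in> S \<Longrightarrow> y \<in> S \<Longrightarrow> x + y \<in> S"
proof -
  show 0: "0 \<in> S"
    using assms by (simp add: add_subgroup_def)
  show d: "x - y \<in> S" if "x \<in> S" "y \<in> S" for x y
    using assms that by (auto simp: add_subgroup_def)
  show m: "- x \<in> S" if "x \<in> S" for x
    using d[OF 0 that] by simp
  show "x + y \<in> S" if "x \<in> S" "y \<in> S" for x y
    using d[OF that(1) m[OF that(2)]] by simp
qed

lemma prism_in_subgroup:
  assumes "add_subgroup S"
    and "\<And>t. length t = Suc (length s) \<Longrightarrow> set t \<subseteq> \<tau> ` set s \<union> \<tau>' ` set s \<Longrightarrow> g t \<in> S"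
  shows "prism \<tau> \<tau>' g s \<in> S"
  using assms(2)
proof (induction s arbitrary: g)
  case (Cons x s)
  have "prism \<tau> \<tau>' (\<lambda>t. g (\<tau> x # t)) s \<in> S"
    by (rule Cons.IH) (auto intro!: Cons.prems)
  moreover have "g (\<tau> x # \<tau>' x # map \<tau>' s) \<in> S"
    by (rule Cons.prems) auto
  ultimately show ?case
    using assms(1) by (auto intro: add_subgroupD)
qed (use assms(1) in \<open>auto intro: add_subgroupD\<close>)

section \<open>Cosets and direct limits\<close>

lemma coset_eq_iff:
  assumes "add_subgroup B"
  shows "coset B x = coset B y \<longleftrightarrow> x - y \<in> B"
proof
  assume "coset B x = coset B y"
  moreover have "x \<in> coset B x"
    using add_subgroupD(1)[OF assms] by (auto simp: coset_def intro: image_eqI[of _ _ 0])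
  ultimately show "x - y \<in> B" by (auto simp: coset_def)
next
  have *: "coset B x \<subseteq> coset B y" if "x - y \<in> B" for x y
  proof
    fix z assume "z \<in> coset B x"
    then obtain b where b: "b \<in> B" "z = x + b" by (auto simp: coset_def)
    show "z \<in> coset B y"
      unfolding coset_def
      by (rule image_eqI[of _ _ "(x - y) + b"]) (use b that add_subgroupD(4)[OF assms] in auto)
  qed
  assume "x - y \<in> B"
  moreover from this have "y - x \<in> B"
    using add_subgroupD(3)[OF assms] by fastforce
  ultimately show "coset B x = coset B y"
    using * by blast
qed

lemma self_in_coset: "add_subgroup B \<Longrightarrow> x \<in> coset B x"
  by (auto simp: coset_def add_subgroupD intro: image_eqI[of _ _ 0])

lemma in_coset_iff: "z \<in> coset B x \<longleftrightarrow> z - x \<in> B"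
  by (auto simp: coset_def intro: image_eqI[of _ _ "z - x"])

lemma coset_zero: "coset B 0 = B"
  by (auto simp: coset_def)

locale quotient_setup =
  fixes sc :: "'k \<Rightarrow> 'a \<Rightarrow> 'a::ab_group_add" and Z B :: "'a set"
  assumes Z: "add_subgroup Z" and B: "add_subgroup B"
    and sc_add: "sc k (x + y) = sc k x + sc k y"
    and sc_Z: "x \<in> Z \<Longrightarrow> sc k x \<in> Z" and sc_B: "x \<in> B \<Longrightarrow> sc k x \<in> B"
begin

lemma quotient_add: "vadd (quotient_space sc Z B) (coset B x) (coset B y) = coset B (x + y)"
proof -
  have "z \<in> coset B (x + y) \<longleftrightarrow> (\<exists>u v. z = u + v \<and> u \<in> coset B x \<and> v \<in> coset B y)" for z
  proof
    assume "z \<in> coset B (x + y)"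
    then have "z = (z - y) + y" "z - y \<in> coset B x" "y \<in> coset B y"
      using add_subgroupD(1)[OF B] by (simp_all add: in_coset_iff diff_diff_eq add.commute)
    then show "\<exists>u v. z = u + v \<and> u \<in> coset B x \<and> v \<in> coset B y" by blast
  next
    assume "\<exists>u v. z = u + v \<and> u \<in> coset B x \<and> v \<in> coset B y"
    then obtain u v where uv: "z = u + v" "u - x \<in> B" "v - y \<in> B" by (auto simp: in_coset_iff)
    then show "z \<in> coset B (x + y)"
      using add_subgroupD(4)[OF B uv(2,3)] by (simp add: in_coset_iff add_diff_add[symmetric])
  qed
  then show ?thesis by (auto simp: quotient_space_def)
qed

text \<open>The scalar multiple is defined as a union of cosets over all representatives;
  \<open>sc_B\<close> makes these one and the same coset.\<close>

lemma quotient_smult: "vsmult (quotient_space sc Z B) k (coset B x) = coset B (sc k x)"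
proof -
  have "coset B (sc k u) = coset B (sc k x)" if "u \<in> coset B x" for u
  proof -
    have "sc k u = sc k (u - x) + sc k x"
      by (simp flip: sc_add)
    then show ?thesis
      using that sc_B by (auto simp: coset_eq_iff[OF B] in_coset_iff)
  qed
  then have "(\<Union>u\<in>coset B x. coset B (sc k u)) = (\<Union>u\<in>coset B x. coset B (sc k x))"
    by (rule SUP_cong[OF refl])
  then show ?thesis
    using self_in_coset[OF B, of x] by (auto simp: quotient_space_def)
qed

end

text \<open>Here \<open>t\<close> is a last index, so the limit is just \<open>V t\<close>.\<close>

locale direct_system_with_last =
  fixes D :: "'d set" and le :: "'d \<Rightarrow> 'd \<Rightarrow> bool" and V :: "'d \<Rightarrow> ('k, 'a) vspace"
    and \<phi> :: "'d \<Rightarrow> 'd \<Rightarrow> 'a \<Rightarrow> 'a" and t :: 'd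
  assumes t_in: "t \<in> D" and le_t: "d \<in> D \<Longrightarrow> le d t"
    and \<phi>_in: "\<lbrakk>d \<in> D; x \<in> vcarrier (V d)\<rbrakk> \<Longrightarrow> \<phi> d t x \<in> vcarrier (V t)"
    and \<phi>_comp: "\<lbrakk>d \<in> D; d' \<in> D; le d d'; x \<in> vcarrier (V d)\<rbrakk>
      \<Longrightarrow> \<phi> d' t (\<phi> d d' x) = \<phi> d t x"
    and \<phi>_id: "x \<in> vcarrier (V t) \<Longrightarrow> \<phi> t t x = x"
    and \<phi>_add: "\<lbrakk>d \<in> D; x \<in> vcarrier (V d); y \<in> vcarrier (V d)\<rbrakk>
      \<Longrightarrow> vadd (V d) x y \<in> vcarrier (V d) \<and> \<phi> d t (vadd (V d) x y) = vadd (V t) (\<phi> d t x) (\<phi> d t y)"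
    and \<phi>_smult: "\<lbrakk>d \<in> D; x \<in> vcarrier (V d)\<rbrakk>
      \<Longrightarrow> vsmult (V d) k x \<in> vcarrier (V d) \<and> \<phi> d t (vsmult (V d) k x) = vsmult (V t) k (\<phi> d t x)"
    and \<phi>_zero: "d \<in> D \<Longrightarrow> vzero (V d) \<in> vcarrier (V d) \<and> \<phi> d t (vzero (V d)) = vzero (V t)"
begin

definition lim_class :: "'a \<Rightarrow> ('d \<times> 'a) set" where
  "lim_class X = {(d, x). d \<in> D \<and> x \<in> vcarrier (V d) \<and> \<phi> d t x = X}"

text \<open>An index at which two elements agree can be pushed on to \<open>t\<close> by
  \<open>\<phi>_comp\<close>; conversely \<open>t\<close> is itself such an index.\<close>

lemma dirlim_rel_eq:
  "dirlim_rel D le V \<phi> = {((d, x), (d', x')).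
     d \<in> D \<and> x \<in> vcarrier (V d) \<and> d' \<in> D \<and> x' \<in> vcarrier (V d') \<and> \<phi> d t x = \<phi> d' t x'}"
proof -
  have "(\<exists>d''\<in>D. le d d'' \<and> le d' d'' \<and> \<phi> d d'' x = \<phi> d' d'' x') \<longleftrightarrow> \<phi> d t x = \<phi> d' t x'"
    if "d \<in> D" "x \<in> vcarrier (V d)" "d' \<in> D" "x' \<in> vcarrier (V d')" for d d' x x'
    using that t_in le_t by (metis \<phi>_comp)
  then show ?thesis
    unfolding dirlim_rel_def by blast
qed

text \<open>Zero, sums, multiples and induced maps are all defined as the image of some set of
  representatives under the relation. This evaluates each of them, whatever representatives the set
  happens to contain.\<close>

lemma rel_image_eq_lim_class:
  assumes "S \<noteq> {}" "\<And>d x. (d, x) \<in> S \<Longrightarrow> d \<in> D \<and> x \<in> vcarrier (V d) \<and> \<phi> d t x = X"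
  shows "dirlim_rel D le V \<phi> `` S = lim_class X"
proof -
  obtain d x where dx: "(d, x) \<in> S" using assms(1) by auto
  have "p \<in> lim_class X \<longleftrightarrow> (\<exists>q\<in>S. (q, p) \<in> dirlim_rel D le V \<phi>)" for p
  proof
    assume "p \<in> lim_class X"
    then have "((d, x), p) \<in> dirlim_rel D le V \<phi>"
      using assms(2)[OF dx] by (auto simp: dirlim_rel_eq lim_class_def)
    then show "\<exists>q\<in>S. (q, p) \<in> dirlim_rel D le V \<phi>" using dx by blast
  next
    assume "\<exists>q\<in>S. (q, p) \<in> dirlim_rel D le V \<phi>"
    then obtain d x where "(d, x) \<in> S" "((d, x), p) \<in> dirlim_rel D le V \<phi>" by auto
    then show "p \<in> lim_class X"
      using assms(2)[of d x] by (auto simp: dirlim_rel_eq lim_class_def)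
  qed
  then show ?thesis by blast
qed

lemma lim_class_self: "X \<in> vcarrier (V t) \<Longrightarrow> (t, X) \<in> lim_class X"
  by (simp add: lim_class_def t_in \<phi>_id)

lemma direct_limit_carrier: "vcarrier (direct_limit D le V \<phi>) = lim_class ` vcarrier (V t)"
proof -
  have *: "dirlim_rel D le V \<phi> `` {(d, x)} = lim_class (\<phi> d t x)"
    if "d \<in> D" "x \<in> vcarrier (V d)" for d x
    by (rule rel_image_eq_lim_class) (use that in auto)
  have "(SIGMA d:D. vcarrier (V d)) // dirlim_rel D le V \<phi> = lim_class ` vcarrier (V t)"
  proof (intro equalityI subsetI)
    fix \<xi> assume "\<xi> \<in> (SIGMA d:D. vcarrier (V d)) // dirlim_rel D le V \<phi>"
    then obtain d x where "d \<in> D" "x \<in> vcarrier (V d)" "\<xi> = dirlim_rel D le V \<phi> `` {(d, x)}"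
      by (auto elim!: quotientE)
    then show "\<xi> \<in> lim_class ` vcarrier (V t)"
      using * \<phi>_in by simp
  next
    fix \<xi> assume "\<xi> \<in> lim_class ` vcarrier (V t)"
    then obtain X where X: "X \<in> vcarrier (V t)" "\<xi> = lim_class X" by auto
    then have "\<xi> = dirlim_rel D le V \<phi> `` {(t, X)}"
      using *[OF t_in X(1)] \<phi>_id by simp
    then show "\<xi> \<in> (SIGMA d:D. vcarrier (V d)) // dirlim_rel D le V \<phi>"
      using X(1) t_in by (simp add: quotientI)
  qed
  then show ?thesis by (simp add: direct_limit_def Let_def)
qed

lemma direct_limit_zero: "vzero (direct_limit D le V \<phi>) = lim_class (vzero (V t))"
  unfolding direct_limit_def Let_def vspace.simps
  by (rule rel_image_eq_lim_class) (use t_in \<phi>_zero in auto)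

lemma direct_limit_smult:
  assumes "X \<in> vcarrier (V t)"
  shows "vsmult (direct_limit D le V \<phi>) k (lim_class X) = lim_class (vsmult (V t) k X)"
  unfolding direct_limit_def Let_def vspace.simps
  by (rule rel_image_eq_lim_class)
    (use lim_class_self[OF assms] \<phi>_smult in \<open>auto simp: lim_class_def\<close>)

lemma direct_limit_add:
  assumes "X \<in> vcarrier (V t)" "Y \<in> vcarrier (V t)"
  shows "vadd (direct_limit D le V \<phi>) (lim_class X) (lim_class Y) = lim_class (vadd (V t) X Y)"
  unfolding direct_limit_def Let_def vspace.simps
  by (rule rel_image_eq_lim_class)
    (use assms[THEN lim_class_self] \<phi>_add in \<open>auto simp: lim_class_def\<close>)

end

section \<open>Cech cohomology of Alexandrov spaces\<close>

text \<open>Sections are families over the points, so a cochain is a function of a simplex and a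
  point \<omega>, and all identities can be checked at fixed \<omega>. The condition concerns each
  entry of the list separately; hence faces and vertex maps preserve it at once.\<close>

definition simplices_at :: "'a set set \<Rightarrow> nat \<Rightarrow> 'a \<Rightarrow> 'a set list set" where
  "simplices_at \<U> n \<omega> = {s. length s = Suc n \<and> set s \<subseteq> {U \<in> \<U>. \<omega> \<in> U}}"

lemma simplices_at_iff: "s \<in> simplices_at \<U> n \<omega> \<longleftrightarrow> s \<in> simplices \<U> n \<and> \<omega> \<in> \<Inter>(set s)"
  by (auto simp: simplices_at_def simplices_def)

lemma map_in_simplices_at:
  "refinement_map \<U> \<V> \<tau> \<Longrightarrow> s \<in> simplices_at \<V> n \<omega> \<Longrightarrow> map \<tau> s \<in> simplices_at \<U> n \<omega>"
  by (fastforce simp: simplices_at_def refinement_map_def)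

lemma simplices_at_shorter:
  "s \<in> simplices_at \<U> (Suc n) \<omega> \<Longrightarrow> length s = Suc (length t) \<Longrightarrow> set t \<subseteq> set s \<Longrightarrow>
    t \<in> simplices_at \<U> n \<omega>"
  by (auto simp: simplices_at_def)

lemma sum_fun_apply: "sum f J x = (\<Sum>j\<in>J. f j x)"
  by (induction J rule: infinite_finite_induct) auto

lemma pscale_sheaf_of: "pscale (sheaf_of G) k x \<omega> = fscale G k (x \<omega>)"
  by (simp add: sheaf_of_def)

lemma cochains_sheaf_iff:
  "c \<in> cochains (sheaf_of G) \<U> n \<longleftrightarrow>
     (\<forall>s \<omega>. s \<in> simplices_at \<U> n \<omega> \<longrightarrow> c s \<omega> \<in> obj G \<omega>) \<and>
     (\<forall>s \<omega>. s \<notin> simplices_at \<U> n \<omega> \<longrightarrow> c s \<omega> = 0) \<and>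
     (\<forall>s \<alpha> \<beta>. s \<in> simplices_at \<U> n \<alpha> \<longrightarrow> s \<in> simplices_at \<U> n \<beta> \<longrightarrow> \<beta> \<subseteq> \<alpha> \<longrightarrow>
        mor G \<alpha> \<beta> (c s \<alpha>) = c s \<beta>)"
  (is "?L \<longleftrightarrow> ?R")
proof
  assume ?L
  then show ?R
    unfolding cochains_def sheaf_of_def simplices_at_iff by fastforce
next
  assume R: ?R
  have "c s = 0" if "s \<notin> simplices \<U> n" for s
    using R that by (auto simp: simplices_at_iff fun_eq_iff)
  moreover have "c s \<in> sections (sheaf_of G) (\<Inter>(set s))" if "s \<in> simplices \<U> n" for s
    using R that by (auto simp: simplices_at_iff sheaf_of_def)
  ultimately show ?L by (auto simp: cochains_def)
qed

lemma cochain_in_obj: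
  "c \<in> cochains (sheaf_of G) \<U> n \<Longrightarrow> s \<in> simplices_at \<U> n \<omega> \<Longrightarrow> c s \<omega> \<in> obj G \<omega>"
  and cochain_vanish:
  "c \<in> cochains (sheaf_of G) \<U> n \<Longrightarrow> s \<notin> simplices_at \<U> n \<omega> \<Longrightarrow> c s \<omega> = 0"
  and cochain_mor:
  "c \<in> cochains (sheaf_of G) \<U> n \<Longrightarrow> s \<in> simplices_at \<U> n \<alpha> \<Longrightarrow> s \<in> simplices_at \<U> n \<beta> \<Longrightarrow>
    \<beta> \<subseteq> \<alpha> \<Longrightarrow> mor G \<alpha> \<beta> (c s \<alpha>) = c s \<beta>"
  by (auto simp: cochains_sheaf_iff)

text \<open>Restriction in \<open>sheaf_of\<close> only truncates families, so at a point of the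
  intersection it disappears from the formula.\<close>

lemma coboundary_sheaf_apply:
  "coboundary (sheaf_of G) \<U> n c s \<omega> =
     (if s \<in> simplices_at \<U> (Suc n) \<omega> then alt_sum (\<lambda>t. c t \<omega>) s else 0)"
proof (cases "s \<in> simplices \<U> (Suc n)")
  case True
  then have len: "{..Suc n} = {..<length s}"
    by (auto simp: simplices_def)
  show ?thesis
  proof (cases "\<omega> \<in> \<Inter>(set s)")
    case \<omega>: True
    then have "coboundary (sheaf_of G) \<U> n c s \<omega> =
        (\<Sum>j<length s. if even j then c (omit j s) \<omega> else - c (omit j s) \<omega>)"
      using True unfolding coboundary_def len
      by (auto simp: sum_fun_apply sheaf_of_def Let_def intro!: sum.cong)
    then show ?thesis
      using True \<omega> unfolding alt_sum_eq_sum_omit by (simp only: simplices_at_iff) simp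
  next
    case False
    then have "coboundary (sheaf_of G) \<U> n c s \<omega> = (\<Sum>j<length s. 0)"
      using True unfolding coboundary_def len
      by (simp only: if_True sum_fun_apply) (intro sum.cong, auto simp: sheaf_of_def Let_def)
    then show ?thesis
      using False by (simp only: simplices_at_iff) simp
  qed
qed (auto simp: coboundary_def simplices_at_iff)

lemma pull_cochain_sheaf_apply:
  "pull_cochain (sheaf_of G) \<V> n \<tau> c s \<omega> = (if s \<in> simplices_at \<V> n \<omega> then c (map \<tau> s) \<omega> else 0)"
  by (auto simp: pull_cochain_def simplices_at_iff sheaf_of_def)

lemma cocycles_sheaf_iff:
  "c \<in> cocycles (sheaf_of G) \<U> n \<longleftrightarrow> c \<in> cochains (sheaf_of G) \<U> n \<and>
     (\<forall>s \<omega>. s \<in> simplices_at \<U> (Suc n) \<omega> \<longrightarrow> alt_sum (\<lambda>t. c t \<omega>) s = 0)"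
  by (auto simp: cocycles_def fun_eq_iff coboundary_sheaf_apply)

lemma coboundaries_vanish:
  "b \<in> coboundaries (sheaf_of G) \<U> n \<Longrightarrow> s \<notin> simplices_at \<U> n \<omega> \<Longrightarrow> b s \<omega> = 0"
  by (auto simp: coboundaries_def coboundary_sheaf_apply split: nat.splits)

lemma coboundary_diff:
  "coboundary (sheaf_of G) \<U> n (c - c') =
    coboundary (sheaf_of G) \<U> n c - coboundary (sheaf_of G) \<U> n c'"
  by (auto simp: fun_eq_iff coboundary_sheaf_apply alt_sum_diff)

lemma coboundary_zero: "coboundary (sheaf_of G) \<U> n 0 = 0"
  by (auto simp: fun_eq_iff coboundary_sheaf_apply)

section \<open>Pulling cochains back along refinements\<close>

lemma coboundary_pull:
  assumes "refinement_map \<U> \<V> \<tau>"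
  shows "coboundary (sheaf_of G) \<V> n (pull_cochain (sheaf_of G) \<V> n \<tau> c) =
    pull_cochain (sheaf_of G) \<V> (Suc n) \<tau> (coboundary (sheaf_of G) \<U> n c)"
proof (intro ext)
  fix s \<omega>
  have "alt_sum (\<lambda>t. pull_cochain (sheaf_of G) \<V> n \<tau> c t \<omega>) s = alt_sum (\<lambda>t. c t \<omega>) (map \<tau> s)"
    if "s \<in> simplices_at \<V> (Suc n) \<omega>"
    unfolding alt_sum_map[symmetric] pull_cochain_sheaf_apply
    by (rule alt_sum_cong) (use simplices_at_shorter[OF that] in auto)
  then show "coboundary (sheaf_of G) \<V> n (pull_cochain (sheaf_of G) \<V> n \<tau> c) s \<omega> =
    pull_cochain (sheaf_of G) \<V> (Suc n) \<tau> (coboundary (sheaf_of G) \<U> n c) s \<omega>"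
    using map_in_simplices_at[OF assms, of s "Suc n" \<omega>]
    by (simp add: coboundary_sheaf_apply pull_cochain_sheaf_apply[of G \<V> "Suc n"])
qed

lemma pull_cochain_diff:
  "pull_cochain (sheaf_of G) \<V> n \<tau> (c - c') =
    pull_cochain (sheaf_of G) \<V> n \<tau> c - pull_cochain (sheaf_of G) \<V> n \<tau> c'"
  by (auto simp: fun_eq_iff pull_cochain_sheaf_apply)

lemma pull_cochain_add:
  "pull_cochain (sheaf_of G) \<V> n \<tau> (c + c') =
    pull_cochain (sheaf_of G) \<V> n \<tau> c + pull_cochain (sheaf_of G) \<V> n \<tau> c'"
  by (auto simp: fun_eq_iff pull_cochain_sheaf_apply)

lemma pull_cochain_comp:
  "refinement_map \<U> \<V> \<tau> \<Longrightarrow> pull_cochain (sheaf_of G) \<V> n \<tau> (pull_cochain (sheaf_of G) \<U> n \<sigma> c) =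
    pull_cochain (sheaf_of G) \<V> n (\<sigma> \<circ> \<tau>) c"
  using map_in_simplices_at by (fastforce simp: fun_eq_iff pull_cochain_sheaf_apply)

lemma pull_cochain_id:
  "c \<in> cochains (sheaf_of G) \<U> n \<Longrightarrow> pull_cochain (sheaf_of G) \<U> n id c = c"
  by (auto simp: fun_eq_iff pull_cochain_sheaf_apply cochains_sheaf_iff)

lemma refinement_map_comp:
  "refinement_map \<U> \<V> \<sigma> \<Longrightarrow> refinement_map \<V> \<W> \<tau> \<Longrightarrow> refinement_map \<U> \<W> (\<sigma> \<circ> \<tau>)"
  by (fastforce simp: refinement_map_def)

lemma refines_iff_refinement_map: "refines \<V> \<U> \<longleftrightarrow> (\<exists>\<tau>. refinement_map \<U> \<V> \<tau>)"
  unfolding refines_def refinement_map_def by (metis (lifting))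

section \<open>The covering by minimal open sets\<close>

abbreviation minimal_cover :: "'i set set \<Rightarrow> 'i set set set" where
  "minimal_cover \<A> \<equiv> lower_set \<A> ` \<A>"

lemma topspace_alexandrov: "topspace (alexandrov \<A>) = \<A>"
  unfolding topspace_def by (auto simp: openin_alexandrov)

lemma open_covering_minimal_cover: "open_covering (alexandrov \<A>) (minimal_cover \<A>)"
  by (auto simp: open_covering_def openin_alexandrov topspace_alexandrov lower_set_def)

lemma minimal_cover_refines:
  assumes "open_covering (alexandrov \<A>) \<U>"
  shows "refines (minimal_cover \<A>) \<U>"
  unfolding refines_def
proof
  fix V assume "V \<in> minimal_cover \<A>"
  then obtain \<alpha> where \<alpha>: "\<alpha> \<in> \<A>" "V = lower_set \<A> \<alpha>" by auto
  then obtain U where U: "U \<in> \<U>" "\<alpha> \<in> U"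
    using assms by (auto simp: open_covering_def topspace_alexandrov)
  then have "V \<subseteq> U"
    using assms \<alpha> by (auto simp: open_covering_def openin_alexandrov lower_set_def)
  then show "\<exists>U\<in>\<U>. V \<subseteq> U" using U by auto
qed

lemma simplices_at_vertex:
  "open_covering (alexandrov \<A>) \<U> \<Longrightarrow> s \<in> simplices_at \<U> n \<omega> \<Longrightarrow> \<omega> \<in> \<A>"
  by (cases s) (auto simp: simplices_at_def open_covering_def openin_alexandrov)

text \<open>Additivity and compatibility with scalars are asked on the whole type \<open>'v\<close>,
  so that they apply to cochain values without side conditions on membership.\<close>

locale linear_functor =
  fixes \<A> :: "'i set set" and G :: "('i, 'k, 'v::ab_group_add) vfunctor"
  assumes obj_subgroup: "\<alpha> \<in> \<A> \<Longrightarrow> add_subgroup (obj G \<alpha>)"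
    and obj_scale: "\<alpha> \<in> \<A> \<Longrightarrow> x \<in> obj G \<alpha> \<Longrightarrow> fscale G k x \<in> obj G \<alpha>"
    and mor_additive: "additive (mor G \<alpha> \<beta>)"
    and fscale_additive: "additive (fscale G k)"
    and mor_scale: "mor G \<alpha> \<beta> (fscale G k x) = fscale G k (mor G \<alpha> \<beta> x)"
begin

abbreviation "covers \<equiv> {\<U>. open_covering (alexandrov \<A>) \<U>}"
abbreviation "C \<equiv> cochains (sheaf_of G)"
abbreviation "Z \<equiv> cocycles (sheaf_of G)"
abbreviation "B \<equiv> coboundaries (sheaf_of G)"
abbreviation "sc \<equiv> (\<lambda>k c s. pscale (sheaf_of G) k (c s))"
abbreviation "pull \<equiv> pull_cochain (sheaf_of G)"

lemma cochains_subgroup: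
  assumes "\<U> \<in> covers"
  shows "add_subgroup (C \<U> n)"
proof -
  have "add_subgroup (obj G \<omega>)" if "s \<in> simplices_at \<U> n \<omega>" for s \<omega>
    using obj_subgroup simplices_at_vertex assms that by blast
  note obj = add_subgroupD[OF this]
  have "0 \<in> C \<U> n"
    using obj(1) by (auto simp: cochains_sheaf_iff additive.zero[OF mor_additive])
  moreover have "c - c' \<in> C \<U> n" if "c \<in> C \<U> n" "c' \<in> C \<U> n" for c c'
    using obj(2) cochain_in_obj[OF that(1)] cochain_in_obj[OF that(2)]
    unfolding cochains_sheaf_iff[of "c - c'"]
    by (auto simp: additive.diff[OF mor_additive] cochain_mor[OF that(1)] cochain_mor[OF that(2)]
        cochain_vanish[OF that(1)] cochain_vanish[OF that(2)])
  ultimately show ?thesis by (auto simp: add_subgroup_def)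
qed

lemma cochains_scale: "\<U> \<in> covers \<Longrightarrow> c \<in> C \<U> n \<Longrightarrow> sc k c \<in> C \<U> n"
  using obj_scale simplices_at_vertex[of \<A> \<U>]
  by (auto simp: cochains_sheaf_iff pscale_sheaf_of additive.zero[OF fscale_additive] mor_scale)

lemma scale_add: "sc k (c + c') = sc k c + sc k c'"
  by (auto simp: fun_eq_iff pscale_sheaf_of additive.add[OF fscale_additive])

lemma coboundary_scale:
  "coboundary (sheaf_of G) \<U> n (sc k c) = sc k (coboundary (sheaf_of G) \<U> n c)"
  by (auto simp: fun_eq_iff coboundary_sheaf_apply pscale_sheaf_of
      additive.alt_sum[OF fscale_additive] additive.zero[OF fscale_additive])

lemma pull_scale: "pull \<V> n \<tau> (sc k c) = sc k (pull \<V> n \<tau> c)"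
  by (auto simp: fun_eq_iff pull_cochain_sheaf_apply pscale_sheaf_of additive.zero[OF fscale_additive])

lemma scale_zero: "(\<lambda>s. pscale (sheaf_of G) k 0) = 0"
  by (auto simp: fun_eq_iff pscale_sheaf_of additive.zero[OF fscale_additive])

lemma cohomology_setup:
  assumes "\<U> \<in> covers"
  shows "quotient_setup sc (Z \<U> n) (B \<U> n)"
proof
  show "add_subgroup (Z \<U> n)"
    using cochains_subgroup[OF assms, of n]
    by (auto simp: add_subgroup_def cocycles_def coboundary_diff coboundary_zero)
  have "add_subgroup (coboundary (sheaf_of G) \<U> m ` C \<U> m)" for m
    unfolding add_subgroup_def
  proof (intro conjI ballI)
    show "0 \<in> coboundary (sheaf_of G) \<U> m ` C \<U> m"
      using add_subgroupD(1)[OF cochains_subgroup[OF assms]] coboundary_zero by (metis image_eqI)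
    fix x y assume "x \<in> coboundary (sheaf_of G) \<U> m ` C \<U> m" "y \<in> coboundary (sheaf_of G) \<U> m ` C \<U> m"
    then show "x - y \<in> coboundary (sheaf_of G) \<U> m ` C \<U> m"
      using add_subgroupD(2)[OF cochains_subgroup[OF assms, of m]]
      by (auto simp flip: coboundary_diff)
  qed
  then show "add_subgroup (B \<U> n)"
    by (auto simp: coboundaries_def add_subgroup_def split: nat.splits)
  show "sc k (x + y) = sc k x + sc k y" for k x y
    by (rule scale_add)
  show "sc k x \<in> Z \<U> n" if "x \<in> Z \<U> n" for k x
    using that cochains_scale[OF assms] by (auto simp: cocycles_def coboundary_scale scale_zero)
  show "sc k x \<in> B \<U> n" if "x \<in> B \<U> n" for k x
    using that cochains_scale[OF assms]
    by (auto simp: coboundaries_def scale_zero simp flip: coboundary_scale split: nat.splits)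
qed

lemma B_subgroup: "\<U> \<in> covers \<Longrightarrow> add_subgroup (B \<U> n)"
  and Z_subgroup: "\<U> \<in> covers \<Longrightarrow> add_subgroup (Z \<U> n)"
  using cohomology_setup quotient_setup.B quotient_setup.Z by blast+

lemma pull_cochains:
  assumes "refinement_map \<U> \<V> \<tau>" "c \<in> C \<U> n"
  shows "pull \<V> n \<tau> c \<in> C \<V> n"
  using assms(2) map_in_simplices_at[OF assms(1)]
  by (auto simp: cochains_sheaf_iff pull_cochain_sheaf_apply)

lemma pull_zero: "pull \<V> n \<tau> 0 = 0"
  by (auto simp: fun_eq_iff pull_cochain_sheaf_apply)

lemma pull_cocycles:
  assumes "refinement_map \<U> \<V> \<tau>" "c \<in> Z \<U> n"
  shows "pull \<V> n \<tau> c \<in> Z \<V> n"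
  using assms(2) pull_cochains[OF assms(1)]
  by (auto simp: cocycles_def coboundary_pull[OF assms(1)] pull_zero)

lemma pull_coboundaries:
  assumes "refinement_map \<U> \<V> \<tau>" "c \<in> B \<U> n"
  shows "pull \<V> n \<tau> c \<in> B \<V> n"
  using assms(2) pull_cochains[OF assms(1)]
  by (auto simp: coboundaries_def pull_zero coboundary_pull[OF assms(1), symmetric] split: nat.splits)

text \<open>If a set contains \<omega>, so do its images under \<tau> and \<tau>'. Every mixed list
  of the prism over a simplex at \<omega> is therefore a simplex at \<omega>, and the homotopy can
  be taken point by point.\<close>

lemma pull_homotopic:
  assumes \<V>: "\<V> \<in> covers"
    and \<tau>: "refinement_map \<U> \<V> \<tau>" and \<tau>': "refinement_map \<U> \<V> \<tau>'" and c: "c \<in> Z \<U> n"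
  shows "pull \<V> n \<tau>' c - pull \<V> n \<tau> c \<in> B \<V> n"
proof -
  have cC: "c \<in> C \<U> n" and d0: "\<And>s \<omega>. s \<in> simplices_at \<U> (Suc n) \<omega> \<Longrightarrow> alt_sum (\<lambda>t. c t \<omega>) s = 0"
    using c by (auto simp: cocycles_sheaf_iff)
  have in_\<U>: "t \<in> simplices_at \<U> m \<omega>"
    if "length t = Suc m" "set t \<subseteq> \<tau> ` set s \<union> \<tau>' ` set s" "s \<in> simplices_at \<V> m' \<omega>" for t s m m' \<omega>
    using that \<tau> \<tau>' unfolding simplices_at_def refinement_map_def by fastforce
  have hom: "alt_sum (prism \<tau> \<tau>' (\<lambda>u. c u \<omega>)) s = c (map \<tau>' s) \<omega> - c (map \<tau> s) \<omega>"
    if s: "s \<in> simplices_at \<V> n \<omega>" for s \<omega>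
  proof -
    \<comment> \<open>The lists occurring here have \<open>n + 2\<close> entries, so they are
      simplices of dimension \<open>Suc n\<close>, where the cocycle condition gives 0.\<close>
    have "prism \<tau> \<tau>' (alt_sum (\<lambda>u. c u \<omega>)) s = prism \<tau> \<tau>' (\<lambda>u. 0) s"
      by (rule prism_cong, rule d0, rule in_\<U>[OF _ _ s]) (use s in \<open>auto simp: simplices_at_def\<close>)
    then show ?thesis
      using prism_homotopy[of \<tau> \<tau>' "\<lambda>u. c u \<omega>" s] by simp
  qed
  show ?thesis
  proof (cases n)
    case 0
    \<comment> \<open>In degree 0 only 0 is a coboundary. On a one-element list the left side of
      \<open>hom\<close> is the prism over the empty list, which is 0, so the two pullbacks
      coincide.\<close>
    have "pull \<V> n \<tau>' c s \<omega> = pull \<V> n \<tau> c s \<omega>" for s \<omega>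
    proof (cases "s \<in> simplices_at \<V> n \<omega>")
      case True
      then obtain U where "s = [U]" using 0 by (auto simp: simplices_at_def length_Suc_conv)
      then show ?thesis
        using hom[OF True] by (simp add: pull_cochain_sheaf_apply)
    qed (simp add: pull_cochain_sheaf_apply)
    then have "pull \<V> n \<tau>' c - pull \<V> n \<tau> c = 0" by (simp add: fun_eq_iff)
    then show ?thesis using add_subgroupD(1)[OF B_subgroup[OF \<V>]] by simp
  next
    case (Suc m)
    have in_n: "t \<in> simplices_at \<U> n \<omega>"
      if "length t = Suc (length s)" "set t \<subseteq> \<tau> ` set s \<union> \<tau>' ` set s" "s \<in> simplices_at \<V> m \<omega>"
      for t s \<omega>
      by (rule in_\<U>[OF _ that(2,3)]) (use that Suc in \<open>auto simp: simplices_at_def\<close>)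
    \<comment> \<open>The prism lengthens lists by one entry, so from \<open>c\<close> in degree
      \<open>n = Suc m\<close> it produces a cochain in degree \<open>m\<close>.\<close>
    define h where "h = (\<lambda>s \<omega>. if s \<in> simplices_at \<V> m \<omega> then prism \<tau> \<tau>' (\<lambda>u. c u \<omega>) s else 0)"
    have "h \<in> C \<V> m"
      unfolding cochains_sheaf_iff
    proof (intro conjI allI impI)
      fix s \<omega> assume s: "s \<in> simplices_at \<V> m \<omega>"
      then have "add_subgroup (obj G \<omega>)"
        using obj_subgroup simplices_at_vertex \<V> by blast
      then have "prism \<tau> \<tau>' (\<lambda>u. c u \<omega>) s \<in> obj G \<omega>"
      proof (rule prism_in_subgroup)
        fix t assume "length t = Suc (length s)" "set t \<subseteq> \<tau> ` set s \<union> \<tau>' ` set s"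
        from in_n[OF this s] show "c t \<omega> \<in> obj G \<omega>" using cC by (auto simp: cochains_sheaf_iff)
      qed
      then show "h s \<omega> \<in> obj G \<omega>" using s by (simp add: h_def)
    next
      fix s \<omega> assume "s \<notin> simplices_at \<V> m \<omega>"
      then show "h s \<omega> = 0" by (simp add: h_def)
    next
      fix s \<alpha> \<beta> assume s: "s \<in> simplices_at \<V> m \<alpha>" "s \<in> simplices_at \<V> m \<beta>" and "\<beta> \<subseteq> \<alpha>"
      have "prism \<tau> \<tau>' (\<lambda>u. mor G \<alpha> \<beta> (c u \<alpha>)) s = prism \<tau> \<tau>' (\<lambda>u. c u \<beta>) s"
      proof (rule prism_cong)
        fix t assume "length t = Suc (length s)" "set t \<subseteq> \<tau> ` set s \<union> \<tau>' ` set s"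
        from in_n[OF this s(1)] in_n[OF this s(2)] show "mor G \<alpha> \<beta> (c t \<alpha>) = c t \<beta>"
          using cC \<open>\<beta> \<subseteq> \<alpha>\<close> by (auto simp: cochains_sheaf_iff)
      qed
      then show "mor G \<alpha> \<beta> (h s \<alpha>) = h s \<beta>"
        using s by (simp add: h_def additive.prism[OF mor_additive])
    qed
    moreover have "coboundary (sheaf_of G) \<V> m h = pull \<V> n \<tau>' c - pull \<V> n \<tau> c"
    proof (intro ext)
      fix s \<omega>
      show "coboundary (sheaf_of G) \<V> m h s \<omega> = (pull \<V> n \<tau>' c - pull \<V> n \<tau> c) s \<omega>"
      proof (cases "s \<in> simplices_at \<V> n \<omega>")
        case True
        have "alt_sum (\<lambda>t. h t \<omega>) s = alt_sum (prism \<tau> \<tau>' (\<lambda>u. c u \<omega>)) s"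
          by (rule alt_sum_cong)
            (use True Suc simplices_at_shorter in \<open>fastforce simp: h_def\<close>)
        then show ?thesis
          using True hom[OF True] Suc by (simp add: coboundary_sheaf_apply pull_cochain_sheaf_apply)
      qed (simp add: coboundary_sheaf_apply pull_cochain_sheaf_apply Suc)
    qed
    ultimately show ?thesis
      unfolding coboundaries_def Suc by (metis (no_types, lifting) image_eqI nat.simps(5))
  qed
qed

text \<open>Another representative changes the pullback by a pulled back coboundary, another
  refinement map by the coboundary from \<open>pull_homotopic\<close>.\<close>

lemma refine_class_coset:
  assumes \<U>: "\<U> \<in> covers" and \<V>: "\<V> \<in> covers" and \<tau>: "refinement_map \<U> \<V> \<tau>" and c: "c \<in> Z \<U> n"
  shows "refine_class (sheaf_of G) n \<U> \<V> (coset (B \<U> n) c) = coset (B \<V> n) (pull \<V> n \<tau> c)"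
proof -
  have "coset (B \<V> n) (pull \<V> n \<tau>' c') = coset (B \<V> n) (pull \<V> n \<tau> c)"
    if \<tau>': "refinement_map \<U> \<V> \<tau>'" and c': "c' \<in> coset (B \<U> n) c" for \<tau>' c'
  proof -
    have "pull \<V> n \<tau>' (c' - c) \<in> B \<V> n"
      using c' by (intro pull_coboundaries[OF \<tau>']) (simp add: in_coset_iff)
    then have "pull \<V> n \<tau>' (c' - c) + (pull \<V> n \<tau>' c - pull \<V> n \<tau> c) \<in> B \<V> n"
      using add_subgroupD(4)[OF B_subgroup[OF \<V>]] pull_homotopic[OF \<V> \<tau> \<tau>' c] by blast
    then show ?thesis
      by (simp add: coset_eq_iff[OF B_subgroup[OF \<V>]] pull_cochain_diff)
  qed
  then have "refine_class (sheaf_of G) n \<U> \<V> (coset (B \<U> n) c) =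
      (\<Union>\<tau>'\<in>{\<tau>'. refinement_map \<U> \<V> \<tau>'}. \<Union>c'\<in>coset (B \<U> n) c. coset (B \<V> n) (pull \<V> n \<tau> c))"
    unfolding refine_class_def by (intro SUP_cong refl) simp
  then show ?thesis
    using \<tau> self_in_coset[OF B_subgroup[OF \<U>], of c n] by auto
qed

section \<open>Cohomology of one covering and passage to the limit\<close>

lemma cover_cohomology_carrier:
  "vcarrier (cover_cohomology (sheaf_of G) n \<U>) = coset (B \<U> n) ` Z \<U> n"
  by (simp add: cover_cohomology_def quotient_space_def)

lemma cover_cohomology_zero: "vzero (cover_cohomology (sheaf_of G) n \<U>) = coset (B \<U> n) 0"
  by (simp add: cover_cohomology_def quotient_space_def coset_zero)

lemma cover_cohomology_add:
  "\<U> \<in> covers \<Longrightarrow> vadd (cover_cohomology (sheaf_of G) n \<U>) (coset (B \<U> n) c) (coset (B \<U> n) c') =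
    coset (B \<U> n) (c + c')"
  unfolding cover_cohomology_def by (rule quotient_setup.quotient_add[OF cohomology_setup])

lemma cover_cohomology_smult:
  "\<U> \<in> covers \<Longrightarrow> vsmult (cover_cohomology (sheaf_of G) n \<U>) k (coset (B \<U> n) c) =
    coset (B \<U> n) (sc k c)"
  unfolding cover_cohomology_def by (rule quotient_setup.quotient_smult[OF cohomology_setup])

lemma cocycles_scale: "\<U> \<in> covers \<Longrightarrow> c \<in> Z \<U> n \<Longrightarrow> sc k c \<in> Z \<U> n"
  by (rule quotient_setup.sc_Z[OF cohomology_setup])

text \<open>Larger indices are finer coverings, so the finest one is a last index. The conditions
  are checked on cosets of cocycles with a chosen refinement map, as
  \<open>refine_class_coset\<close> permits.\<close>

sublocale limit: direct_system_with_last covers "\<lambda>\<U> \<V>. refines \<V> \<U>"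
  "cover_cohomology (sheaf_of G) n" "refine_class (sheaf_of G) n" "minimal_cover \<A>" for n
proof
  let ?M = "minimal_cover \<A>"
  show M: "?M \<in> covers"
    by (simp add: open_covering_minimal_cover)
  have to_M: "\<exists>\<tau>. refinement_map \<U> ?M \<tau>" if "\<U> \<in> covers" for \<U>
    using minimal_cover_refines that by (auto simp: refines_iff_refinement_map)
  fix \<U> X assume \<U>: "\<U> \<in> covers"
  then obtain \<tau> where \<tau>: "refinement_map \<U> ?M \<tau>" using to_M by auto
  note ref = refine_class_coset[OF \<U> M \<tau>]
  note Zg = add_subgroupD[OF Z_subgroup[OF \<U>]]
  show "refines ?M \<U>" using \<tau> by (auto simp: refines_iff_refinement_map)
  show "vzero (cover_cohomology (sheaf_of G) n \<U>) \<in> vcarrier (cover_cohomology (sheaf_of G) n \<U>) \<and>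
      refine_class (sheaf_of G) n \<U> ?M (vzero (cover_cohomology (sheaf_of G) n \<U>)) =
      vzero (cover_cohomology (sheaf_of G) n ?M)"
    using Zg(1) by (auto simp: cover_cohomology_carrier cover_cohomology_zero ref pull_zero)
  assume X: "X \<in> vcarrier (cover_cohomology (sheaf_of G) n \<U>)"
  then obtain c where c: "c \<in> Z \<U> n" "X = coset (B \<U> n) c"
    by (auto simp: cover_cohomology_carrier)
  show "refine_class (sheaf_of G) n \<U> ?M X \<in> vcarrier (cover_cohomology (sheaf_of G) n ?M)"
    using c pull_cocycles[OF \<tau>] by (auto simp: ref cover_cohomology_carrier)
  show "vsmult (cover_cohomology (sheaf_of G) n \<U>) k X \<in> vcarrier (cover_cohomology (sheaf_of G) n \<U>) \<and>
      refine_class (sheaf_of G) n \<U> ?M (vsmult (cover_cohomology (sheaf_of G) n \<U>) k X) =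
      vsmult (cover_cohomology (sheaf_of G) n ?M) k (refine_class (sheaf_of G) n \<U> ?M X)" for k
    using c cocycles_scale[OF \<U> c(1)]
    by (simp add: cover_cohomology_smult[OF \<U>] cover_cohomology_smult[OF M] ref pull_scale
        cover_cohomology_carrier)
  show "vadd (cover_cohomology (sheaf_of G) n \<U>) X Y \<in> vcarrier (cover_cohomology (sheaf_of G) n \<U>) \<and>
      refine_class (sheaf_of G) n \<U> ?M (vadd (cover_cohomology (sheaf_of G) n \<U>) X Y) =
      vadd (cover_cohomology (sheaf_of G) n ?M) (refine_class (sheaf_of G) n \<U> ?M X)
        (refine_class (sheaf_of G) n \<U> ?M Y)"
    if Y: "Y \<in> vcarrier (cover_cohomology (sheaf_of G) n \<U>)" for Y
  proof -
    obtain c' where c': "c' \<in> Z \<U> n" "Y = coset (B \<U> n) c'"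
      using Y by (auto simp: cover_cohomology_carrier)
    show ?thesis
      using c c' Zg(4)[OF c(1) c'(1)]
      by (simp add: cover_cohomology_add[OF \<U>] cover_cohomology_add[OF M] ref pull_cochain_add
          cover_cohomology_carrier)
  qed
  fix \<V> assume \<V>: "\<V> \<in> covers" and "refines \<V> \<U>"
  then obtain \<sigma> where \<sigma>: "refinement_map \<U> \<V> \<sigma>" by (auto simp: refines_iff_refinement_map)
  obtain \<rho> where \<rho>: "refinement_map \<V> ?M \<rho>" using to_M[OF \<V>] by auto
  show "refine_class (sheaf_of G) n \<V> ?M (refine_class (sheaf_of G) n \<U> \<V> X) =
      refine_class (sheaf_of G) n \<U> ?M X"
    using c(1) unfolding c(2) refine_class_coset[OF \<U> \<V> \<sigma> c(1)]
      refine_class_coset[OF \<V> M \<rho> pull_cocycles[OF \<sigma> c(1)]]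
      refine_class_coset[OF \<U> M refinement_map_comp[OF \<sigma> \<rho>] c(1)]
    by (simp add: pull_cochain_comp[OF \<rho>])
next
  fix X assume "X \<in> vcarrier (cover_cohomology (sheaf_of G) n (minimal_cover \<A>))"
  then obtain c where c: "c \<in> Z (minimal_cover \<A>) n" "X = coset (B (minimal_cover \<A>) n) c"
    by (auto simp: cover_cohomology_carrier)
  have "refinement_map (minimal_cover \<A>) (minimal_cover \<A>) id"
    by (simp add: refinement_map_def)
  from refine_class_coset[OF _ _ this c(1)] c
  show "refine_class (sheaf_of G) n (minimal_cover \<A>) (minimal_cover \<A>) X = X"
    by (simp add: open_covering_minimal_cover pull_cochain_id cocycles_def)
qed

text \<open>The class in the limit of a cocycle on the minimal covering. From here on
  \<open>cohom\<close> is handled through such cocycles only.\<close>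

definition cohom_class :: "nat \<Rightarrow> ('i set set list \<Rightarrow> 'i set \<Rightarrow> 'v) \<Rightarrow> ('i set, 'i set \<Rightarrow> 'v) cech_class" where
  "cohom_class n c = limit.lim_class n (coset (B (minimal_cover \<A>) n) c)"

abbreviation "cocyc n \<equiv> Z (minimal_cover \<A>) n"

lemma coset_in_carrier:
  "c \<in> cocyc n \<Longrightarrow>
    coset (B (minimal_cover \<A>) n) c \<in> vcarrier (cover_cohomology (sheaf_of G) n (minimal_cover \<A>))"
  by (simp add: cover_cohomology_carrier)

lemma cohom_carrier: "vcarrier (cohom \<A> G n) = cohom_class n ` cocyc n"
  by (simp add: cohom_def cech_cohomology_def limit.direct_limit_carrier cover_cohomology_carrier
      cohom_class_def image_image)

lemma cohom_zero: "vzero (cohom \<A> G n) = cohom_class n 0"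
  by (simp add: cohom_def cech_cohomology_def limit.direct_limit_zero cover_cohomology_zero
      cohom_class_def)

lemma cohom_add:
  "c \<in> cocyc n \<Longrightarrow> c' \<in> cocyc n \<Longrightarrow>
    vadd (cohom \<A> G n) (cohom_class n c) (cohom_class n c') = cohom_class n (c + c')"
  by (simp add: cohom_def cech_cohomology_def limit.direct_limit_add coset_in_carrier
      cohom_class_def cover_cohomology_add open_covering_minimal_cover)

lemma cohom_smult:
  "c \<in> cocyc n \<Longrightarrow> vsmult (cohom \<A> G n) k (cohom_class n c) = cohom_class n (sc k c)"
  by (simp add: cohom_def cech_cohomology_def limit.direct_limit_smult coset_in_carrier
      cohom_class_def cover_cohomology_smult open_covering_minimal_cover)

lemma cohom_class_cong:
  "c - c' \<in> B (minimal_cover \<A>) n \<Longrightarrow> cohom_class n c = cohom_class n c'"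
  using coset_eq_iff[OF B_subgroup[of "minimal_cover \<A>" n], of c c']
  by (simp add: cohom_class_def open_covering_minimal_cover)

lemma cocyc_add: "c \<in> cocyc n \<Longrightarrow> c' \<in> cocyc n \<Longrightarrow> c + c' \<in> cocyc n"
  and zero_cocyc: "0 \<in> cocyc n"
  and cocyc_scale: "c \<in> cocyc n \<Longrightarrow> sc k c \<in> cocyc n"
  using add_subgroupD(1,4)[OF Z_subgroup] cocycles_scale by (auto simp: open_covering_minimal_cover)

end

text \<open>Naturality is asked on \<open>obj G \<alpha>\<close> only: it is to cover
  \<open>push (f \<alpha>)\<close> for a morphism \<open>f\<close> that is controlled only on the
  points of the product over \<alpha>.\<close>

locale linear_transformation =
  G: linear_functor \<A> G + G': linear_functor \<A> G'
  for \<A> :: "'i set set" and G :: "('i, 'k, 'v::ab_group_add) vfunctor"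
    and G' :: "('i, 'k, 'w::ab_group_add) vfunctor" +
  fixes \<eta> :: "'i set \<Rightarrow> 'v \<Rightarrow> 'w"
  assumes \<eta>_additive: "additive (\<eta> \<alpha>)"
    and \<eta>_scale: "\<eta> \<alpha> (fscale G k x) = fscale G' k (\<eta> \<alpha> x)"
    and \<eta>_obj: "\<alpha> \<in> \<A> \<Longrightarrow> x \<in> obj G \<alpha> \<Longrightarrow> \<eta> \<alpha> x \<in> obj G' \<alpha>"
    and \<eta>_natural: "\<lbrakk>\<alpha> \<in> \<A>; \<beta> \<in> \<A>; \<beta> \<subseteq> \<alpha>; x \<in> obj G \<alpha>\<rbrakk> \<Longrightarrow> mor G' \<alpha> \<beta> (\<eta> \<alpha> x) = \<eta> \<beta> (mor G \<alpha> \<beta> x)"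
begin

definition app :: "('i set set list \<Rightarrow> 'i set \<Rightarrow> 'v) \<Rightarrow> 'i set set list \<Rightarrow> 'i set \<Rightarrow> 'w" where
  "app c = (\<lambda>s \<omega>. \<eta> \<omega> (c s \<omega>))"

lemma app_zero: "app 0 = 0" and app_add: "app (c + c') = app c + app c'"
  and app_diff: "app (c - c') = app c - app c'" and app_scale: "app (G.sc k c) = G'.sc k (app c)"
  by (auto simp: app_def fun_eq_iff additive.zero[OF \<eta>_additive] additive.add[OF \<eta>_additive]
      additive.diff[OF \<eta>_additive] pscale_sheaf_of \<eta>_scale)

lemma app_cochains: "\<U> \<in> G.covers \<Longrightarrow> c \<in> G.C \<U> n \<Longrightarrow> app c \<in> G'.C \<U> n"
  using \<eta>_obj simplices_at_vertex[of \<A> \<U>]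
  by (auto simp: cochains_sheaf_iff app_def additive.zero[OF \<eta>_additive] \<eta>_natural)

lemma coboundary_app: "coboundary (sheaf_of G') \<U> n (app c) = app (coboundary (sheaf_of G) \<U> n c)"
  by (auto simp: fun_eq_iff coboundary_sheaf_apply app_def additive.zero[OF \<eta>_additive]
      additive.alt_sum[OF \<eta>_additive])

lemma app_cocycles: "\<U> \<in> G.covers \<Longrightarrow> c \<in> G.Z \<U> n \<Longrightarrow> app c \<in> G'.Z \<U> n"
  using app_cochains by (auto simp: cocycles_def coboundary_app app_zero)

lemma app_cocyc: "c \<in> G.cocyc n \<Longrightarrow> app c \<in> G'.cocyc n"
  by (rule app_cocycles) (auto simp: open_covering_minimal_cover)

lemma app_coboundaries: "\<U> \<in> G.covers \<Longrightarrow> c \<in> G.B \<U> n \<Longrightarrow> app c \<in> G'.B \<U> n"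
  using app_cochains
  by (auto simp: coboundaries_def app_zero coboundary_app[symmetric] split: nat.splits)

lemma pull_app: "pull_cochain (sheaf_of G') \<V> n \<tau> (app c) = app (pull_cochain (sheaf_of G) \<V> n \<tau> c)"
  by (auto simp: fun_eq_iff pull_cochain_sheaf_apply app_def additive.zero[OF \<eta>_additive])

abbreviation "on_sections \<equiv> (\<lambda>W x \<omega>. if \<omega> \<in> W then \<eta> \<omega> (x \<omega>) else 0)"

lemma cover_map_coset:
  assumes \<U>: "\<U> \<in> G.covers" and c: "c \<in> G.Z \<U> n"
  shows "cover_map (sheaf_of G') n on_sections \<U> (coset (G.B \<U> n) c) = coset (G'.B \<U> n) (app c)"
proof -
  \<comment> \<open>\<open>cover_map\<close> truncates to simplices and their intersections. A
    representative differs from the cocycle \<open>c\<close> by a coboundary, and both vanish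
    outside, so truncation changes nothing.\<close>
  have on: "(\<lambda>s. if s \<in> simplices \<U> n then on_sections (\<Inter>(set s)) (c' s) else 0) = app c'"
    if "c' \<in> coset (G.B \<U> n) c" for c'
  proof (intro ext)
    fix s \<omega>
    have "c' s \<omega> = 0" if "s \<notin> simplices_at \<U> n \<omega>"
    proof -
      have "(c' - c) s \<omega> = 0" "c s \<omega> = 0"
        using \<open>c' \<in> _\<close> c that coboundaries_vanish[of "c' - c" G \<U> n s \<omega>]
        by (auto simp: in_coset_iff cocycles_sheaf_iff cochains_sheaf_iff)
      then show ?thesis by simp
    qed
    then show "(if s \<in> simplices \<U> n then on_sections (\<Inter>(set s)) (c' s) else 0) \<omega> = app c' s \<omega>"
      by (auto simp: app_def simplices_at_iff additive.zero[OF \<eta>_additive])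
  qed
  have eq: "coset (G'.B \<U> n) (\<lambda>s. if s \<in> simplices \<U> n then on_sections (\<Inter>(set s)) (c' s) else 0) =
      coset (G'.B \<U> n) (app c)" if "c' \<in> coset (G.B \<U> n) c" for c'
    unfolding on[OF that] using that app_coboundaries[OF \<U>]
    by (simp add: coset_eq_iff[OF G'.B_subgroup[OF \<U>]] in_coset_iff flip: app_diff)
  have "cover_map (sheaf_of G') n on_sections \<U> (coset (G.B \<U> n) c) =
      (\<Union>c'\<in>coset (G.B \<U> n) c. coset (G'.B \<U> n) (app c))"
    unfolding cover_map_def by (intro SUP_cong[OF refl]) (rule eq)
  then show ?thesis
    using self_in_coset[OF G.B_subgroup[OF \<U>], of c] by auto
qed

text \<open>A class has representatives on many coverings and \<open>cech_map\<close> applies the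
  transformation to all of them. Pulled back to the minimal covering they differ from
  \<open>c\<close> by coboundaries; \<open>app\<close> commutes with pulling back and respects
  coboundaries.\<close>

lemma cohom_map_class:
  assumes c: "c \<in> G.cocyc n"
  shows "cohom_map \<A> G' n \<eta> (G.cohom_class n c) = G'.cohom_class n (app c)"
proof -
  let ?M = "minimal_cover \<A>"
  have M: "?M \<in> G.covers" by (simp add: open_covering_minimal_cover)
  have "cohom_map \<A> G' n \<eta> (G.cohom_class n c) = G'.limit.lim_class n (coset (G'.B ?M n) (app c))"
    unfolding cohom_map_def cech_map_def
  proof (rule G'.limit.rel_image_eq_lim_class)
    show "{(\<U>, cover_map (sheaf_of G') n on_sections \<U> C) |\<U> C. (\<U>, C) \<in> G.cohom_class n c} \<noteq> {}"
      using G.limit.lim_class_self[OF G.coset_in_carrier[OF c]] by (auto simp: G.cohom_class_def)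
    fix \<U> D assume "(\<U>, D) \<in> {(\<U>, cover_map (sheaf_of G') n on_sections \<U> C) |\<U> C. (\<U>, C) \<in> G.cohom_class n c}"
    then obtain a where a: "a \<in> G.Z \<U> n" and \<U>: "\<U> \<in> G.covers"
        and D: "D = cover_map (sheaf_of G') n on_sections \<U> (coset (G.B \<U> n) a)"
        and r: "refine_class (sheaf_of G) n \<U> ?M (coset (G.B \<U> n) a) = coset (G.B ?M n) c"
      by (auto simp: G.cohom_class_def G.limit.lim_class_def G.cover_cohomology_carrier)
    obtain \<tau> where \<tau>: "refinement_map \<U> ?M \<tau>"
      using minimal_cover_refines \<U> by (auto simp: refines_iff_refinement_map)
    have "G.pull ?M n \<tau> a - c \<in> G.B ?M n"
      using r by (simp add: G.refine_class_coset[OF \<U> M \<tau> a] coset_eq_iff[OF G.B_subgroup[OF M]])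
    then have "app (G.pull ?M n \<tau> a) - app c \<in> G'.B ?M n"
      using app_coboundaries[OF M] by (simp flip: app_diff)
    then have "coset (G'.B ?M n) (app (G.pull ?M n \<tau> a)) = coset (G'.B ?M n) (app c)"
      by (simp add: coset_eq_iff[OF G'.B_subgroup[OF M]])
    then show "\<U> \<in> G'.covers \<and> D \<in> vcarrier (cover_cohomology (sheaf_of G') n \<U>) \<and>
        refine_class (sheaf_of G') n \<U> ?M D = coset (G'.B ?M n) (app c)"
      using \<U> app_cocycles[OF \<U> a]
      unfolding D cover_map_coset[OF \<U> a] G'.refine_class_coset[OF \<U> M \<tau> app_cocycles[OF \<U> a]] pull_app
      by (simp add: G'.cover_cohomology_carrier)
  qed
  then show ?thesis by (simp add: G'.cohom_class_def)
qed

end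

section \<open>Splittings induce splittings in cohomology\<close>

text \<open>Each value of a cocycle lies in \<open>obj G \<omega>\<close> or is 0, so identities
  valid on objects and at 0 pass to cocycles.\<close>

lemma cocycle_pointwise:
  assumes "c \<in> cocycles (sheaf_of G) \<U> n" "\<And>\<omega>. P \<omega> 0" "\<And>\<omega> v. v \<in> obj G \<omega> \<Longrightarrow> P \<omega> v"
  shows "P \<omega> (c s \<omega>)"
  using assms cochain_in_obj[of c G \<U> n s \<omega>] cochain_vanish[of c G \<U> n s \<omega>]
  by (cases "s \<in> simplices_at \<U> n \<omega>") (auto simp: cocycles_def)

text \<open>The biproduct identities are restricted to objects because the intended ones fail
  elsewhere: the projection to the restricted functor moves every vector whose coordinate sum is not
  0.\<close>

locale functor_splitting =
  i: linear_transformation \<A> G F i + j: linear_transformation \<A> K F j +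
  p: linear_transformation \<A> F G p + q: linear_transformation \<A> F K q
  for \<A> :: "'i set set" and G :: "('i, 'k, 'u::ab_group_add) vfunctor"
    and K :: "('i, 'k, 'w::ab_group_add) vfunctor" and F :: "('i, 'k, 'v::ab_group_add) vfunctor"
    and i j p q +
  assumes p_i: "x \<in> obj G \<alpha> \<Longrightarrow> p \<alpha> (i \<alpha> x) = x"
    and q_i: "x \<in> obj G \<alpha> \<Longrightarrow> q \<alpha> (i \<alpha> x) = 0"
    and p_j: "y \<in> obj K \<alpha> \<Longrightarrow> p \<alpha> (j \<alpha> y) = 0"
    and q_j: "y \<in> obj K \<alpha> \<Longrightarrow> q \<alpha> (j \<alpha> y) = y"
    and i_p_j_q: "z \<in> obj F \<alpha> \<Longrightarrow> i \<alpha> (p \<alpha> z) + j \<alpha> (q \<alpha> z) = z"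
begin

lemmas zeros = i.\<eta>_additive[THEN additive.zero] j.\<eta>_additive[THEN additive.zero]
  p.\<eta>_additive[THEN additive.zero] q.\<eta>_additive[THEN additive.zero]

lemma app_p_i: "c \<in> i.G.cocyc n \<Longrightarrow> p.app (i.app c) = c"
  and app_q_i: "c \<in> i.G.cocyc n \<Longrightarrow> q.app (i.app c) = 0"
  unfolding fun_eq_iff zero_fun_apply i.app_def p.app_def q.app_def
  using cocycle_pointwise[of c G _ n "\<lambda>\<omega> v. p \<omega> (i \<omega> v) = v"]
    cocycle_pointwise[of c G _ n "\<lambda>\<omega> v. q \<omega> (i \<omega> v) = 0"]
  by (simp_all add: p_i q_i zeros)

lemma app_p_j: "c \<in> j.G.cocyc n \<Longrightarrow> p.app (j.app c) = 0"
  and app_q_j: "c \<in> j.G.cocyc n \<Longrightarrow> q.app (j.app c) = c"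
  unfolding fun_eq_iff zero_fun_apply j.app_def p.app_def q.app_def
  using cocycle_pointwise[of c K _ n "\<lambda>\<omega> v. p \<omega> (j \<omega> v) = 0"]
    cocycle_pointwise[of c K _ n "\<lambda>\<omega> v. q \<omega> (j \<omega> v) = v"]
  by (simp_all add: p_j q_j zeros)

lemma app_i_p_j_q: "c \<in> i.G'.cocyc n \<Longrightarrow> i.app (p.app c) + j.app (q.app c) = c"
  unfolding fun_eq_iff plus_fun_apply i.app_def j.app_def p.app_def q.app_def
  using cocycle_pointwise[of c F _ n "\<lambda>\<omega> v. i \<omega> (p \<omega> v) + j \<omega> (q \<omega> v) = v"]
  by (simp add: i_p_j_q zeros)

definition sum_map where
  "sum_map n = (\<lambda>(a, b). vadd (cohom \<A> F n) (cohom_map \<A> F n i a) (cohom_map \<A> F n j b))"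

lemma sum_map_class:
  "c \<in> i.G.cocyc n \<Longrightarrow> d \<in> j.G.cocyc n \<Longrightarrow>
    sum_map n (i.G.cohom_class n c, j.G.cohom_class n d) = i.G'.cohom_class n (i.app c + j.app d)"
  by (simp add: sum_map_def i.cohom_map_class j.cohom_map_class i.G'.cohom_add i.app_cocyc j.app_cocyc)

lemma sum_map_components:
  assumes "c \<in> i.G.cocyc n" "d \<in> j.G.cocyc n"
  shows "cohom_map \<A> G n p (sum_map n (i.G.cohom_class n c, j.G.cohom_class n d)) = i.G.cohom_class n c"
    and "cohom_map \<A> K n q (sum_map n (i.G.cohom_class n c, j.G.cohom_class n d)) = j.G.cohom_class n d"
  using assms
  by (simp_all add: sum_map_class p.cohom_map_class q.cohom_map_class i.G'.cocyc_add i.app_cocyc j.app_cocyc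
      p.app_add q.app_add app_p_i app_q_i app_p_j app_q_j)

text \<open>The maps induced by \<open>p\<close> and \<open>q\<close> are the two components of the
  inverse; on cocycles of the minimal covering the biproduct identities apply value by
  value.\<close>

lemma sum_map_linear_iso:
  "linear_iso (sum_map n) (direct_sum (cohom \<A> G n) (cohom \<A> K n)) (cohom \<A> F n)"
  unfolding linear_iso_def
proof (intro conjI ballI allI)
  have carrier: "vcarrier (direct_sum (cohom \<A> G n) (cohom \<A> K n)) =
      {(i.G.cohom_class n c, j.G.cohom_class n d) | c d. c \<in> i.G.cocyc n \<and> d \<in> j.G.cocyc n}"
    by (auto simp: direct_sum_def i.G.cohom_carrier j.G.cohom_carrier)
  show "bij_betw (sum_map n) (vcarrier (direct_sum (cohom \<A> G n) (cohom \<A> K n))) (vcarrier (cohom \<A> F n))"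
  proof (rule bij_betw_byWitness[where f' = "\<lambda>\<xi>. (cohom_map \<A> G n p \<xi>, cohom_map \<A> K n q \<xi>)"])
    show "\<forall>a\<in>vcarrier (direct_sum (cohom \<A> G n) (cohom \<A> K n)).
        (cohom_map \<A> G n p (sum_map n a), cohom_map \<A> K n q (sum_map n a)) = a"
      by (auto simp: carrier sum_map_components)
    show "\<forall>\<xi>\<in>vcarrier (cohom \<A> F n). sum_map n (cohom_map \<A> G n p \<xi>, cohom_map \<A> K n q \<xi>) = \<xi>"
      by (auto simp: i.G'.cohom_carrier p.cohom_map_class q.cohom_map_class sum_map_class
          p.app_cocyc q.app_cocyc app_i_p_j_q)
    show "sum_map n ` vcarrier (direct_sum (cohom \<A> G n) (cohom \<A> K n)) \<subseteq> vcarrier (cohom \<A> F n)"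
      by (auto simp: carrier sum_map_class i.G'.cohom_carrier i.G'.cocyc_add i.app_cocyc j.app_cocyc)
    show "(\<lambda>\<xi>. (cohom_map \<A> G n p \<xi>, cohom_map \<A> K n q \<xi>)) ` vcarrier (cohom \<A> F n) \<subseteq>
        vcarrier (direct_sum (cohom \<A> G n) (cohom \<A> K n))"
      by (auto simp: i.G'.cohom_carrier p.cohom_map_class q.cohom_map_class p.app_cocyc q.app_cocyc
          i.G.cohom_carrier j.G.cohom_carrier direct_sum_def)
  qed
  fix x assume "x \<in> vcarrier (direct_sum (cohom \<A> G n) (cohom \<A> K n))"
  then obtain c d where x: "x = (i.G.cohom_class n c, j.G.cohom_class n d)"
      and c: "c \<in> i.G.cocyc n" and d: "d \<in> j.G.cocyc n"
    by (auto simp: carrier)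
  show "sum_map n (vsmult (direct_sum (cohom \<A> G n) (cohom \<A> K n)) k x) =
      vsmult (cohom \<A> F n) k (sum_map n x)" for k
  proof -
    have "i.app (i.G.sc k c) + j.app (j.G.sc k d) = i.G'.sc k (i.app c + j.app d)"
      by (simp only: i.app_scale j.app_scale i.G'.scale_add)
    then show ?thesis
      using c d i.G.cocyc_scale[OF c] j.G.cocyc_scale[OF d]
      by (simp add: x direct_sum_def i.G.cohom_smult j.G.cohom_smult i.G'.cohom_smult sum_map_class
          i.G'.cocyc_add i.app_cocyc j.app_cocyc)
  qed
  fix y assume "y \<in> vcarrier (direct_sum (cohom \<A> G n) (cohom \<A> K n))"
  then obtain c' d' where y: "y = (i.G.cohom_class n c', j.G.cohom_class n d')"
      and c': "c' \<in> i.G.cocyc n" and d': "d' \<in> j.G.cocyc n"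
    by (auto simp: carrier)
  have "i.app (c + c') + j.app (d + d') = (i.app c + j.app d) + (i.app c' + j.app d')"
    by (simp add: i.app_add j.app_add algebra_simps)
  then show "sum_map n (vadd (direct_sum (cohom \<A> G n) (cohom \<A> K n)) x y) =
      vadd (cohom \<A> F n) (sum_map n x) (sum_map n y)"
    using c d c' d' i.G.cocyc_add[OF c c'] j.G.cocyc_add[OF d d']
    by (simp add: x y direct_sum_def i.G.cohom_add j.G.cohom_add i.G'.cohom_add sum_map_class
        i.G'.cocyc_add i.app_cocyc j.app_cocyc)
qed

lemma sum_map_left:
  assumes "a \<in> vcarrier (cohom \<A> G n)"
  shows "sum_map n (a, vzero (cohom \<A> K n)) = cohom_map \<A> F n i a"
  using assms
  by (auto simp: i.G.cohom_carrier j.G.cohom_zero sum_map_class j.G.zero_cocyc i.cohom_map_class j.app_zero)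

lemma sum_map_right:
  assumes "a \<in> vcarrier (cohom \<A> G n)" "b \<in> vcarrier (cohom \<A> K n)"
  shows "cohom_map \<A> K n q (sum_map n (a, b)) = b"
  using assms by (auto simp: i.G.cohom_carrier j.G.cohom_carrier sum_map_components)

end

section \<open>Free vector spaces\<close>

abbreviation (input) "scale_free k \<equiv> Poly_Mapping.map ((*) k)"

lemma lookup_scale: "Poly_Mapping.lookup (scale_free k v) x = k * Poly_Mapping.lookup v x"
  for v :: "'x \<Rightarrow>\<^sub>0 'k::field"
  by (simp add: Poly_Mapping.map.rep_eq when_def)

text \<open>Additivity needs one index set serving \<open>v\<close>, \<open>w\<close> and
  \<open>v + w\<close>, whose keys can differ through cancellation.\<close>

lemma push_superset:
  assumes "finite S" "Poly_Mapping.keys v \<subseteq> S"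
  shows "push g v = (\<Sum>x\<in>S. Poly_Mapping.single (g x) (Poly_Mapping.lookup v x))"
  unfolding push_def using assms
  by (intro sum.mono_neutral_left) (auto simp: in_keys_iff)

lemma coord_sum_superset:
  assumes "finite S" "Poly_Mapping.keys v \<subseteq> S"
  shows "coord_sum v = (\<Sum>x\<in>S. Poly_Mapping.lookup v x)"
  unfolding coord_sum_def using assms
  by (intro sum.mono_neutral_left) (auto simp: in_keys_iff)

lemma additive_push: "additive (push g :: ('x \<Rightarrow>\<^sub>0 'k::field) \<Rightarrow> _)"
proof
  fix v w :: "'x \<Rightarrow>\<^sub>0 'k"
  let ?S = "Poly_Mapping.keys v \<union> Poly_Mapping.keys w"
  show "push g (v + w) = push g v + push g w"
    using push_superset[of ?S v g] push_superset[of ?S w g] push_superset[of ?S "v + w" g]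
      Poly_Mapping.keys_add[of v w]
    by (simp add: lookup_add single_add sum.distrib)
qed

lemma additive_coord_sum: "additive (coord_sum :: ('x \<Rightarrow>\<^sub>0 'k::field) \<Rightarrow> 'k)"
proof
  fix v w :: "'x \<Rightarrow>\<^sub>0 'k"
  let ?S = "Poly_Mapping.keys v \<union> Poly_Mapping.keys w"
  show "coord_sum (v + w) = coord_sum v + coord_sum w"
    using coord_sum_superset[of ?S v] coord_sum_superset[of ?S w] coord_sum_superset[of ?S "v + w"]
      Poly_Mapping.keys_add[of v w]
    by (simp add: lookup_add sum.distrib)
qed

lemma additive_scale: "additive (scale_free k :: ('x \<Rightarrow>\<^sub>0 'k::field) \<Rightarrow> _)"
  by standard (auto intro!: poly_mapping_eqI simp: lookup_scale lookup_add algebra_simps)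

lemma push_single: "push g (Poly_Mapping.single x c) = Poly_Mapping.single (g x) c"
  using push_superset[of "{x}" "Poly_Mapping.single x c" g] by simp

lemma coord_sum_single: "coord_sum (Poly_Mapping.single x c) = c"
  using coord_sum_superset[of "{x}" "Poly_Mapping.single x c"] by simp

lemma scale_single:
  "scale_free k (Poly_Mapping.single x c) = Poly_Mapping.single x (k * c)" for k :: "'k::field"
  by (rule poly_mapping_eqI) (simp add: lookup_scale lookup_single when_def)

lemma push_cong: "(\<And>x. x \<in> Poly_Mapping.keys v \<Longrightarrow> g x = h x) \<Longrightarrow> push g v = push h v"
  by (simp add: push_def)

lemma push_id: "(\<And>x. x \<in> Poly_Mapping.keys v \<Longrightarrow> g x = x) \<Longrightarrow> push g v = v"
proof (rule poly_mapping_eqI)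
  fix y assume "\<And>x. x \<in> Poly_Mapping.keys v \<Longrightarrow> g x = x"
  then have "push g v = (\<Sum>x\<in>Poly_Mapping.keys v. Poly_Mapping.single x (Poly_Mapping.lookup v x))"
    by (simp add: push_def)
  then show "Poly_Mapping.lookup (push g v) y = Poly_Mapping.lookup v y"
    by (simp add: lookup_sum lookup_single when_def in_keys_iff sum.delta)
qed

lemma push_push: "push g (push h v) = push (\<lambda>x. g (h x)) v"
  unfolding push_def[of h] push_def[of "\<lambda>x. g (h x)"]
  by (simp add: additive.sum[OF additive_push] push_single)

lemma coord_sum_push: "coord_sum (push g v) = coord_sum v"
  unfolding push_def
  by (simp add: additive.sum[OF additive_coord_sum] coord_sum_single) (simp add: coord_sum_def)

lemma keys_scale: "Poly_Mapping.keys (scale_free k v) \<subseteq> Poly_Mapping.keys v" for v :: "'x \<Rightarrow>\<^sub>0 'k::field"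
  by (auto simp: in_keys_iff lookup_scale)

lemma push_scale: "push g (scale_free k v) = scale_free k (push g v)"
  using push_superset[of "Poly_Mapping.keys v" "scale_free k v" g] keys_scale[of k v]
  by (simp add: push_def[of g v] additive.sum[OF additive_scale] scale_single lookup_scale)

lemma coord_sum_scale: "coord_sum (scale_free k v) = k * coord_sum v"
  using coord_sum_superset[of "Poly_Mapping.keys v" "scale_free k v"] keys_scale[of k v]
  by (simp add: coord_sum_def[of v] sum_distrib_left lookup_scale)

lemma keys_diff_subset:
  "Poly_Mapping.keys v \<subseteq> S \<Longrightarrow> Poly_Mapping.keys w \<subseteq> S \<Longrightarrow> Poly_Mapping.keys (v - w) \<subseteq> S"
  for v w :: "'x \<Rightarrow>\<^sub>0 'k::field"
  using keys_diff[of v w] by blast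

lemma keys_push: "Poly_Mapping.keys (push g v) \<subseteq> g ` Poly_Mapping.keys v"
  unfolding push_def using keys_sum by (fastforce split: if_splits)

lemma push_const: "(\<And>x. x \<in> Poly_Mapping.keys v \<Longrightarrow> g x = y) \<Longrightarrow> push g v = Poly_Mapping.single y (coord_sum v)"
proof -
  assume "\<And>x. x \<in> Poly_Mapping.keys v \<Longrightarrow> g x = y"
  then have "push g v = (\<Sum>x\<in>Poly_Mapping.keys v. Poly_Mapping.single y (Poly_Mapping.lookup v x))"
    by (simp add: push_def)
  also have "\<dots> = Poly_Mapping.single y (coord_sum v)"
    unfolding coord_sum_def by (rule additive.sum[symmetric]) (simp add: additive_def single_add)
  finally show ?thesis .
qed

section \<open>The Moebius decomposition of a product functor\<close>

definition mobius_diff :: "('i set \<Rightarrow> 'v::ab_group_add) \<Rightarrow> 'i set \<Rightarrow> 'v" where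
  "mobius_diff f T = (\<Sum>S\<in>Pow T. if even (card (T - S)) then f S else - f S)"

lemma sum_Pow_insert:
  assumes "finite T" "i \<notin> T"
  shows "(\<Sum>S\<in>Pow (insert i T). g S) = (\<Sum>S\<in>Pow T. g S) + (\<Sum>S\<in>Pow T. g (insert i S))"
proof -
  have "inj_on (insert i) (Pow T)"
    using assms(2) by (intro inj_onI) (metis Diff_insert_absorb PowD subsetD)
  moreover have "Pow T \<inter> insert i ` Pow T = {}"
    using assms(2) by auto
  ultimately show ?thesis
    using assms(1) by (simp add: Pow_insert sum.union_disjoint sum.reindex)
qed

lemma mobius_diff_cong: "(\<And>S. S \<subseteq> T \<Longrightarrow> f S = g S) \<Longrightarrow> mobius_diff f T = mobius_diff g T"
  by (auto simp: mobius_diff_def intro!: sum.cong)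

text \<open>Subsets avoiding \<open>i\<close> change sign when \<open>i\<close> joins
  \<open>T\<close>. So \<open>mobius_diff\<close> is an iterated difference, one direction for each
  element of \<open>T\<close>.\<close>

lemma mobius_diff_insert:
  assumes "finite T" "i \<notin> T"
  shows "mobius_diff f (insert i T) = mobius_diff (\<lambda>S. f (insert i S)) T - mobius_diff f T"
proof -
  have "(\<Sum>S\<in>Pow T. if even (card (insert i T - S)) then f S else - f S) = - mobius_diff f T"
    unfolding mobius_diff_def sum_negf[symmetric]
  proof (rule sum.cong[OF refl])
    fix S assume "S \<in> Pow T"
    then have "insert i T - S = insert i (T - S)"
      using assms(2) by auto
    then have "card (insert i T - S) = Suc (card (T - S))"
      using assms by simp
    then show "(if even (card (insert i T - S)) then f S else - f S) =
        - (if even (card (T - S)) then f S else - f S)"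
      by simp
  qed
  moreover have "insert i T - insert i S = T - S" if "S \<subseteq> T" for S
    using assms(2) that by auto
  then have "(\<Sum>S\<in>Pow T. if even (card (insert i T - insert i S)) then f (insert i S) else - f (insert i S)) =
      mobius_diff (\<lambda>S. f (insert i S)) T"
    unfolding mobius_diff_def by (intro sum.cong[OF refl]) simp
  ultimately show ?thesis
    unfolding mobius_diff_def[of f "insert i T"] by (simp add: sum_Pow_insert[OF assms])
qed

text \<open>Induction with \<open>f\<close> arbitrary: the sets containing \<open>i\<close>
  contribute differences whose second parts cancel the sets without \<open>i\<close>, which leaves
  the sum for \<open>\<lambda>S. f (insert i S)\<close>.\<close>

lemma sum_mobius_diff: "finite U \<Longrightarrow> (\<Sum>T\<in>Pow U. mobius_diff f T) = f U"
proof (induction U arbitrary: f rule: finite_induct)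
  case (insert i U)
  have "(\<Sum>T\<in>Pow U. mobius_diff f (insert i T)) =
      (\<Sum>T\<in>Pow U. mobius_diff (\<lambda>S. f (insert i S)) T - mobius_diff f T)"
    using insert.hyps by (intro sum.cong[OF refl] mobius_diff_insert) (auto intro: finite_subset)
  then show ?case
    by (simp add: sum_Pow_insert[OF insert.hyps(1,2)] sum_subtractf insert.IH[of "\<lambda>S. f (insert i S)"])
qed (simp add: mobius_diff_def)

text \<open>Already the difference in direction \<open>i\<close> is 0. This will kill the summands
  of sets not contained in the target of a restriction.\<close>

lemma mobius_diff_eq_zero:
  assumes "finite T" "i \<in> T" "\<And>S. S \<subseteq> T \<Longrightarrow> f (insert i S) = f S"
  shows "mobius_diff f T = 0"
proof -
  have "mobius_diff (\<lambda>S. f (insert i S)) (T - {i}) = mobius_diff f (T - {i})"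
    using assms(3) by (intro mobius_diff_cong) auto
  then show ?thesis
    using mobius_diff_insert[of "T - {i}" i f] assms(1,2) by (simp add: insert_absorb)
qed

lemma (in additive) mobius_diff: "f (mobius_diff g T) = mobius_diff (\<lambda>S. f (g S)) T"
  unfolding mobius_diff_def sum by (intro sum.cong) (auto simp: minus)

lemma add_subgroup_sum:
  assumes "add_subgroup S" "\<And>x. x \<in> X \<Longrightarrow> f x \<in> S"
  shows "(\<Sum>x\<in>X. f x) \<in> S"
  using assms(2)
  by (induction X rule: infinite_finite_induct) (auto intro: add_subgroupD[OF assms(1)])

lemma mobius_diff_in_subgroup:
  assumes "add_subgroup V" "\<And>S. S \<subseteq> T \<Longrightarrow> f S \<in> V"
  shows "mobius_diff f T \<in> V"
  unfolding mobius_diff_def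
  by (rule add_subgroup_sum[OF assms(1)]) (auto intro: assms(2) add_subgroupD[OF assms(1)])

text \<open>For \<open>S \<subseteq> \<gamma>\<close> the value \<open>undefined\<close> off
  \<gamma> puts the result into the extensional product over \<gamma>. Of \<open>x\<close> only the
  coordinates in \<open>S\<close> are read, so \<open>x\<close> may come from the product over any
  set containing \<open>S\<close>.\<close>

definition overwrite :: "('i \<Rightarrow> 'e) \<Rightarrow> 'i set \<Rightarrow> 'i set \<Rightarrow> ('i \<Rightarrow> 'e) \<Rightarrow> 'i \<Rightarrow> 'e" where
  "overwrite e \<gamma> S x = (\<lambda>i. if i \<in> S then x i else if i \<in> \<gamma> then e i else undefined)"

text \<open>The component of a vector of \<open>F\<^sub>\<delta>\<close>, for any \<open>\<delta> \<supseteq> T\<close>, in the summand of \<open>T\<close>, seen in \<open>F\<^sub>\<gamma>\<close>: Moebius inversion,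
  as \<open>push (overwrite e \<gamma> S)\<close> is the projection onto the summands of all subsets of \<open>S\<close>.\<close>

definition component :: "('i \<Rightarrow> 'e) \<Rightarrow> 'i set \<Rightarrow> 'i set \<Rightarrow> (('i \<Rightarrow> 'e) \<Rightarrow>\<^sub>0 'k::field) \<Rightarrow> ('i \<Rightarrow> 'e) \<Rightarrow>\<^sub>0 'k" where
  "component e \<gamma> T v = mobius_diff (\<lambda>S. push (overwrite e \<gamma> S) v) T"

lemma additive_component: "additive (component e \<gamma> T :: (('i \<Rightarrow> 'e) \<Rightarrow>\<^sub>0 'k::field) \<Rightarrow> _)"
proof
  fix v w :: "('i \<Rightarrow> 'e) \<Rightarrow>\<^sub>0 'k"
  show "component e \<gamma> T (v + w) = component e \<gamma> T v + component e \<gamma> T w"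
    unfolding component_def mobius_diff_def sum.distrib[symmetric]
    by (intro sum.cong) (auto simp: additive.add[OF additive_push])
qed

lemma sum_components:
  assumes "finite \<gamma>" "Poly_Mapping.keys v \<subseteq> Pi\<^sub>E \<gamma> E" "coord_sum v = 0"
  shows "(\<Sum>T\<in>Pow \<gamma> - {{}}. component e \<gamma> T v) = v"
proof -
  \<comment> \<open>With no coordinate kept, overwriting is the constant map to the base point, so
    this component is the coordinate sum times one basis vector.\<close>
  have "component e \<gamma> {} v = 0"
    using push_const[of v "overwrite e \<gamma> {}" "restrict e \<gamma>"] assms(3)
    by (simp add: component_def mobius_diff_def overwrite_def restrict_def)
  then have "(\<Sum>T\<in>Pow \<gamma> - {{}}. component e \<gamma> T v) = (\<Sum>T\<in>Pow \<gamma>. component e \<gamma> T v)"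
    using assms(1) by (intro sum.mono_neutral_left) auto
  also have "\<dots> = push (overwrite e \<gamma> \<gamma>) v"
    unfolding component_def by (rule sum_mobius_diff[OF assms(1)])
  also have "\<dots> = v"
    using assms(2) by (intro push_id) (auto simp: overwrite_def fun_eq_iff PiE_def extensional_def)
  finally show ?thesis .
qed

text \<open>If \<open>i \<in> T\<close> lies outside \<beta>, restriction forgets whether coordinate
  \<open>i\<close> was overwritten and the terms cancel in pairs. If
  \<open>T \<subseteq> \<beta>\<close>, overwriting commutes with restriction.\<close>

lemma push_restrict_component:
  assumes "\<beta> \<subseteq> \<alpha>" "T \<subseteq> \<alpha>" "finite T"
  shows "push (\<lambda>x. restrict x \<beta>) (component e \<alpha> T v) = (if T \<subseteq> \<beta> then component e \<beta> T v else 0)"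
proof -
  have eq: "push (\<lambda>x. restrict x \<beta>) (component e \<alpha> T v) =
      mobius_diff (\<lambda>S. push (\<lambda>x. restrict (overwrite e \<alpha> S x) \<beta>) v) T"
    by (simp add: component_def additive.mobius_diff[OF additive_push] push_push)
  show ?thesis
  proof (cases "T \<subseteq> \<beta>")
    case True
    have "(\<lambda>x. restrict (overwrite e \<alpha> S x) \<beta>) = overwrite e \<beta> S" if "S \<subseteq> T" for S
      using that True assms(1) by (auto simp: overwrite_def fun_eq_iff)
    then show ?thesis
      using True unfolding eq by (auto simp: component_def intro!: mobius_diff_cong)
  next
    case False
    then obtain i where i: "i \<in> T" "i \<notin> \<beta>" by auto
    have "(\<lambda>x. restrict (overwrite e \<alpha> (insert i S) x) \<beta>) = (\<lambda>x. restrict (overwrite e \<alpha> S x) \<beta>)" for S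
      using i(2) by (auto simp: overwrite_def fun_eq_iff restrict_def)
    then show ?thesis
      using False i(1) assms(3) unfolding eq by (simp add: mobius_diff_eq_zero)
  qed
qed

text \<open>Only the coordinates in \<open>T\<close> are read. Thus the part of a vector in the
  summand of \<open>T\<close> is recovered from its restriction to any \<delta> containing
  \<open>T\<close>, which is the constancy of the summand in the form needed for lifting.\<close>

lemma component_push_restrict:
  assumes "T \<subseteq> \<delta>"
  shows "component e \<gamma> T (push (\<lambda>x. restrict x \<delta>) v) = component e \<gamma> T v"
proof -
  have "(\<lambda>x. overwrite e \<gamma> S (restrict x \<delta>)) = overwrite e \<gamma> S" if "S \<subseteq> T" for S
    using that assms by (auto simp: overwrite_def fun_eq_iff)
  then show ?thesis
    unfolding component_def push_push by (auto intro!: mobius_diff_cong)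
qed

section \<open>The free, restricted free and constant functors are linear\<close>

lemma free_functor_simps:
  "obj (free_functor E) \<alpha> = {v. Poly_Mapping.keys v \<subseteq> Pi\<^sub>E \<alpha> E}"
  "mor (free_functor E) \<alpha> \<beta> = push (\<lambda>x. restrict x \<beta>)"
  "fscale (free_functor E) k = scale_free k"
  "obj (restricted_free_functor E) \<alpha> = {v. Poly_Mapping.keys v \<subseteq> Pi\<^sub>E \<alpha> E \<and> coord_sum v = 0}"
  "mor (restricted_free_functor E) \<alpha> \<beta> = push (\<lambda>x. restrict x \<beta>)"
  "fscale (restricted_free_functor E) k = scale_free k"
  by (auto simp: free_functor_def restricted_free_functor_def)

lemma constant_functor_simps:
  "obj constant_functor \<alpha> = UNIV" "mor constant_functor \<alpha> \<beta> c = c" "fscale constant_functor k = (*) k"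
  by (auto simp: constant_functor_def)

lemma linear_functor_free: "linear_functor \<A> (free_functor E)"
  by standard
    (simp_all add: free_functor_simps add_subgroup_def push_scale additive.add[OF additive_push] additive.add[OF additive_scale]
      order_trans[OF keys_scale] keys_diff_subset)

lemma linear_functor_restricted: "linear_functor \<A> (restricted_free_functor E)"
  by standard
    (simp_all add: free_functor_simps add_subgroup_def push_scale additive.add[OF additive_push] additive.add[OF additive_scale]
      order_trans[OF keys_scale] keys_diff_subset coord_sum_scale
      additive.zero[OF additive_coord_sum] additive.diff[OF additive_coord_sum])

lemma linear_functor_constant: "linear_functor \<A> (constant_functor :: ('i, 'k::field, 'k) vfunctor)"
  by standard (auto simp: constant_functor_simps add_subgroup_def algebra_simps)

lemma component_in_obj:
  assumes "v \<in> obj (restricted_free_functor E) \<delta>" "e \<in> Pi\<^sub>E I E" "\<gamma> \<subseteq> I" "T \<subseteq> \<gamma>" "T \<subseteq> \<delta>"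
  shows "component e \<gamma> T v \<in> obj (restricted_free_functor E) \<gamma>"
  unfolding component_def
proof (rule mobius_diff_in_subgroup)
  show "add_subgroup (obj (restricted_free_functor E) \<gamma>)"
    \<comment> \<open>Instantiating the hypergraph with \<open>UNIV\<close> spares the condition
      that \<gamma> be an edge.\<close>
    using linear_functor.obj_subgroup[OF linear_functor_restricted, of \<gamma> UNIV] by simp
  fix S assume S: "S \<subseteq> T"
  have "overwrite e \<gamma> S x \<in> Pi\<^sub>E \<gamma> E" if "x \<in> Pi\<^sub>E \<delta> E" for x
    using that S assms(2-5) by (auto simp: overwrite_def PiE_iff extensional_def)
  then show "push (overwrite e \<gamma> S) v \<in> obj (restricted_free_functor E) \<gamma>"
    using assms(1) keys_push[of "overwrite e \<gamma> S" v] by (fastforce simp: free_functor_simps coord_sum_push)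
qed

section \<open>Acyclicity of the restricted free sheaf\<close>

text \<open>Each summand is contracted by coning off a vertex depending on \<open>T\<close>; only the finitely many \<open>T \<subseteq> \<omega>\<close>
  contribute to the value at \<open>\<omega>\<close>.\<close>

lemma restricted_cocycle_is_coboundary:
  fixes c :: "'i set set list \<Rightarrow> 'i set \<Rightarrow> (('i \<Rightarrow> 'e) \<Rightarrow>\<^sub>0 'k::field)"
  assumes hyp: "hypergraph I \<A>" and wip: "weak_intersection_property \<A>" and e: "e \<in> Pi\<^sub>E I E"
    and \<U>: "open_covering (alexandrov \<A>) \<U>"
    and c: "c \<in> cocycles (sheaf_of (restricted_free_functor E)) \<U> (Suc m)"
  shows "c \<in> coboundaries (sheaf_of (restricted_free_functor E)) \<U> (Suc m)"
proof -
  let ?F = "restricted_free_functor E :: ('i, 'k, ('i \<Rightarrow> 'e) \<Rightarrow>\<^sub>0 'k) vfunctor"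
  interpret F: linear_functor \<A> ?F by (rule linear_functor_restricted)
  have cC: "c \<in> cochains (sheaf_of ?F) \<U> (Suc m)"
    and d0: "\<And>s \<omega>. s \<in> simplices_at \<U> (Suc (Suc m)) \<omega> \<Longrightarrow> alt_sum (\<lambda>t. c t \<omega>) s = 0"
    using c by (auto simp: cocycles_sheaf_iff)
  \<comment> \<open>The edge \<open>a T\<close> and the member \<open>U T\<close> of the covering
    must depend on \<open>T\<close> alone: for the contraction to commute with restrictions, the
    cone vertex has to be the same at all points.\<close>
  have "\<exists>\<alpha> U. T \<subseteq> \<omega> \<longrightarrow> \<omega> \<in> \<A> \<longrightarrow> \<alpha> \<in> \<A> \<and> T \<subseteq> \<alpha> \<and> U \<in> \<U> \<and> \<alpha> \<in> U" for T \<omega>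
    using \<U> unfolding open_covering_def topspace_alexandrov by (metis UnionE)
  then have "\<exists>\<alpha> U. (\<exists>\<omega>\<in>\<A>. T \<subseteq> \<omega>) \<longrightarrow> \<alpha> \<in> \<A> \<and> T \<subseteq> \<alpha> \<and> U \<in> \<U> \<and> \<alpha> \<in> U" for T
    by metis
  then obtain a U where
    aU: "\<And>T \<omega>. \<omega> \<in> \<A> \<Longrightarrow> T \<subseteq> \<omega> \<Longrightarrow> a T \<in> \<A> \<and> T \<subseteq> a T \<and> U T \<in> \<U> \<and> a T \<in> U T"
    by metis
  have down: "\<beta> \<in> V" if "V \<in> \<U>" "\<alpha> \<in> V" "\<beta> \<in> \<A>" "\<beta> \<subseteq> \<alpha>" for \<alpha> \<beta> V
    using \<U> that by (auto simp: open_covering_def openin_alexandrov)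
  have fin: "finite \<omega>" "\<omega> \<subseteq> I" if "\<omega> \<in> \<A>" for \<omega>
    using hyp that by (auto simp: hypergraph_def)
  have at_A: "\<omega> \<in> \<A>" if "s \<in> simplices_at \<U> n \<omega>" for s n \<omega>
    using simplices_at_vertex[OF \<U> that] .
  \<comment> \<open>The nonempty \<open>T\<close> witnesses that \<open>a T\<close> and \<omega>
    meet, so the weak intersection property applies.\<close>
  have meet: "a T \<inter> \<omega> \<in> \<A>" "T \<subseteq> a T \<inter> \<omega>" if "\<omega> \<in> \<A>" "T \<in> Pow \<omega> - {{}}" for T \<omega>
    using aU[of \<omega> T] that wip unfolding weak_intersection_property_def by blast+
  \<comment> \<open>Open sets are down-closed: the intersection stays in all members of
    \<open>s\<close> because it lies below \<omega>, and in \<open>U T\<close> because it lies below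
    \<open>a T\<close>.\<close>
  have at_meet: "s \<in> simplices_at \<U> n (a T \<inter> \<omega>)"
    and cone: "U T # s \<in> simplices_at \<U> (Suc n) (a T \<inter> \<omega>)"
    if s: "s \<in> simplices_at \<U> n \<omega>" and T: "T \<in> Pow \<omega> - {{}}" for s n T \<omega>
  proof -
    have \<omega>: "\<omega> \<in> \<A>" by (rule at_A[OF s])
    show s': "s \<in> simplices_at \<U> n (a T \<inter> \<omega>)"
      using s down[OF _ _ meet(1)[OF \<omega> T]] by (auto simp: simplices_at_def)
    have "U T \<in> \<U>" "a T \<inter> \<omega> \<in> U T"
      using aU[OF \<omega>, of T] down[OF _ _ meet(1)[OF \<omega> T]] T by auto
    then show "U T # s \<in> simplices_at \<U> (Suc n) (a T \<inter> \<omega>)"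
      using s' by (auto simp: simplices_at_def)
  qed
  \<comment> \<open>The point \<omega> need not lie in \<open>U T\<close>, so the cone simplex is
    evaluated at \<open>a T \<inter> \<omega>\<close>; \<open>component e \<omega> T\<close> then
    transports the part of this value in the summand of \<open>T\<close> to \<omega>.\<close>
  define h where "h = (\<lambda>s \<omega>. if s \<in> simplices_at \<U> m \<omega>
    then \<Sum>T\<in>Pow \<omega> - {{}}. component e \<omega> T (c (U T # s) (a T \<inter> \<omega>)) else 0)"
  have "h \<in> cochains (sheaf_of ?F) \<U> m"
    unfolding cochains_sheaf_iff
  proof (intro conjI allI impI)
    fix s \<omega> assume s: "s \<in> simplices_at \<U> m \<omega>"
    have \<omega>: "\<omega> \<in> \<A>" by (rule at_A[OF s])
    have "component e \<omega> T (c (U T # s) (a T \<inter> \<omega>)) \<in> obj ?F \<omega>" if T: "T \<in> Pow \<omega> - {{}}" for T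
      using T by (intro component_in_obj[OF cochain_in_obj[OF cC cone[OF s T]] e fin(2)[OF \<omega>] _ meet(2)[OF \<omega> T]])
        auto
    then have "(\<Sum>T\<in>Pow \<omega> - {{}}. component e \<omega> T (c (U T # s) (a T \<inter> \<omega>))) \<in> obj ?F \<omega>"
      by (rule add_subgroup_sum[OF F.obj_subgroup[OF \<omega>]])
    then show "h s \<omega> \<in> obj ?F \<omega>"
      using s by (simp add: h_def)
  next
    fix s \<omega> assume "s \<notin> simplices_at \<U> m \<omega>"
    then show "h s \<omega> = 0" by (simp add: h_def)
  next
    fix s \<alpha> \<beta> assume s: "s \<in> simplices_at \<U> m \<alpha>" "s \<in> simplices_at \<U> m \<beta>" and sub: "\<beta> \<subseteq> \<alpha>"
    have \<alpha>: "\<alpha> \<in> \<A>" and \<beta>: "\<beta> \<in> \<A>" using at_A s by auto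
    let ?v = "\<lambda>T. c (U T # s) (a T \<inter> \<alpha>)"
    have "mor ?F \<alpha> \<beta> (h s \<alpha>) =
        (\<Sum>T\<in>Pow \<alpha> - {{}}. if T \<subseteq> \<beta> then component e \<beta> T (?v T) else 0)"
      using s(1) fin(1)[OF \<alpha>]
      by (auto simp: h_def free_functor_simps additive.sum[OF additive_push]
          push_restrict_component[OF sub] finite_subset intro!: sum.cong)
    also have "\<dots> = (\<Sum>T\<in>Pow \<beta> - {{}}. component e \<beta> T (?v T))"
      using fin(1)[OF \<alpha>] sub by (intro sum.mono_neutral_cong_right) auto
    \<comment> \<open>The value at \<open>a T \<inter> \<beta>\<close> is the restriction of the
      value at \<open>a T \<inter> \<alpha>\<close>, and both sets contain \<open>T\<close>, so the
      component is the same.\<close>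
    also have "\<dots> = (\<Sum>T\<in>Pow \<beta> - {{}}. component e \<beta> T (c (U T # s) (a T \<inter> \<beta>)))"
    proof (intro sum.cong refl)
      fix T assume T: "T \<in> Pow \<beta> - {{}}"
      then have T': "T \<in> Pow \<alpha> - {{}}" using sub by auto
      have "c (U T # s) (a T \<inter> \<beta>) = push (\<lambda>x. restrict x (a T \<inter> \<beta>)) (?v T)"
        using cochain_mor[OF cC cone[OF s(1) T'] cone[OF s(2) T] Int_mono[OF subset_refl sub]]
        by (simp add: free_functor_simps)
      then show "component e \<beta> T (?v T) = component e \<beta> T (c (U T # s) (a T \<inter> \<beta>))"
        by (simp add: component_push_restrict[OF meet(2)[OF \<beta> T]])
    qed
    finally show "mor ?F \<alpha> \<beta> (h s \<alpha>) = h s \<beta>"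
      using s(2) by (simp add: h_def)
  qed
  moreover have "coboundary (sheaf_of ?F) \<U> m h = c"
  proof (intro ext)
    fix s \<omega>
    show "coboundary (sheaf_of ?F) \<U> m h s \<omega> = c s \<omega>"
    proof (cases "s \<in> simplices_at \<U> (Suc m) \<omega>")
      case s: True
      have \<omega>: "\<omega> \<in> \<A>" by (rule at_A[OF s])
      have "alt_sum (\<lambda>t. h t \<omega>) s =
          alt_sum (\<lambda>t. \<Sum>T\<in>Pow \<omega> - {{}}. component e \<omega> T (c (U T # t) (a T \<inter> \<omega>))) s"
        by (rule alt_sum_cong) (use simplices_at_shorter[OF s] in \<open>auto simp: h_def\<close>)
      also have "\<dots> = (\<Sum>T\<in>Pow \<omega> - {{}}. component e \<omega> T (alt_sum (\<lambda>t. c (U T # t) (a T \<inter> \<omega>)) s))"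
        by (simp add: alt_sum_sum additive.alt_sum[OF additive_component])
      also have "\<dots> = (\<Sum>T\<in>Pow \<omega> - {{}}. component e \<omega> T (c s \<omega>))"
      proof (intro sum.cong refl)
        fix T assume T: "T \<in> Pow \<omega> - {{}}"
        \<comment> \<open>Deleting the cone vertex from \<open>U T # s\<close> gives
          \<open>s\<close>, so the cocycle condition on this list expresses \<open>c s\<close> by
          the faces that keep the vertex.\<close>
        have "alt_sum (\<lambda>t. c (U T # t) (a T \<inter> \<omega>)) s = c s (a T \<inter> \<omega>)"
          using d0[OF cone[OF s T]] by simp
        also have "\<dots> = push (\<lambda>x. restrict x (a T \<inter> \<omega>)) (c s \<omega>)"
          using cochain_mor[OF cC s at_meet[OF s T]] by (simp add: free_functor_simps)
        finally show "component e \<omega> T (alt_sum (\<lambda>t. c (U T # t) (a T \<inter> \<omega>)) s) = component e \<omega> T (c s \<omega>)"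
          by (simp add: component_push_restrict[OF meet(2)[OF \<omega> T]])
      qed
      also have "\<dots> = c s \<omega>"
        using cochain_in_obj[OF cC s] by (intro sum_components[OF fin(1)[OF \<omega>]]) (auto simp: free_functor_simps)
      finally show ?thesis using s by (simp add: coboundary_sheaf_apply)
    qed (simp add: coboundary_sheaf_apply cochain_vanish[OF cC])
  qed
  ultimately show ?thesis
    unfolding coboundaries_def by (metis (no_types, lifting) image_eqI nat.simps(5))
qed

text \<open>The base point is auxiliary here: any point of the full product provides a contraction,
  and exactness on the minimal covering suffices.\<close>

lemma cohom_restricted_vanishes:
  fixes E :: "'i \<Rightarrow> 'e set"
  assumes "hypergraph I \<A>" "weak_intersection_property \<A>" "product_functor I E" "n > 0"
  shows "vcarrier (cohom \<A> (restricted_free_functor E :: ('i, 'k::field, ('i \<Rightarrow> 'e) \<Rightarrow>\<^sub>0 'k) vfunctor) n) =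
    {vzero (cohom \<A> (restricted_free_functor E) n)}"
proof -
  let ?F = "restricted_free_functor E :: ('i, 'k, ('i \<Rightarrow> 'e) \<Rightarrow>\<^sub>0 'k) vfunctor"
  interpret F: linear_functor \<A> ?F by (rule linear_functor_restricted)
  obtain e where e: "e \<in> Pi\<^sub>E I E" using assms(3) by (auto simp: product_functor_iff_base_point)
  obtain m where m: "n = Suc m" using assms(4) gr0_implies_Suc by blast
  have "F.cohom_class n c = F.cohom_class n 0" if "c \<in> F.cocyc n" for c
    using restricted_cocycle_is_coboundary[OF assms(1,2) e open_covering_minimal_cover] that m
    by (intro F.cohom_class_cong) auto
  then show ?thesis
    unfolding F.cohom_carrier F.cohom_zero using F.zero_cocyc[of n] by blast
qed

section \<open>The splitting of the free sheaf\<close>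

text \<open>The restrictions of the single point \<open>e\<close> form a compatible family, so the
  section of \<open>coord_sum\<close> that they define is natural; subtracting its part of a vector
  projects to the kernel.\<close>

lemma free_splitting:
  fixes E :: "'i \<Rightarrow> 'e set"
  assumes "hypergraph I \<A>" "e \<in> Pi\<^sub>E I E"
  shows "functor_splitting \<A> (restricted_free_functor E) (constant_functor :: ('i, 'k::field, 'k) vfunctor)
    (free_functor E) (\<lambda>\<alpha> v. v) (\<lambda>\<alpha>. Poly_Mapping.single (restrict e \<alpha>))
    (\<lambda>\<alpha> v. v - Poly_Mapping.single (restrict e \<alpha>) (coord_sum v)) (\<lambda>\<alpha> v. coord_sum v)"
proof -
  let ?F = "free_functor E :: ('i, 'k, ('i \<Rightarrow> 'e) \<Rightarrow>\<^sub>0 'k) vfunctor"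
  let ?R = "restricted_free_functor E :: ('i, 'k, ('i \<Rightarrow> 'e) \<Rightarrow>\<^sub>0 'k) vfunctor"
  interpret F: linear_functor \<A> ?F by (rule linear_functor_free)
  interpret R: linear_functor \<A> ?R by (rule linear_functor_restricted)
  interpret K: linear_functor \<A> "constant_functor :: ('i, 'k, 'k) vfunctor" by (rule linear_functor_constant)
  have base: "e i \<in> E i" if "\<alpha> \<in> \<A>" "i \<in> \<alpha>" for \<alpha> i
    using that assms by (auto simp: hypergraph_def)
  note defs = free_functor_simps constant_functor_simps additive_def single_add coord_sum_push
    push_single scale_single coord_sum_single coord_sum_scale
    additive.add[OF additive_push] additive.diff[OF additive_push]
    additive.add[OF additive_coord_sum] additive.diff[OF additive_coord_sum]
    additive.diff[OF additive_scale]
  interpret i: linear_transformation \<A> ?R ?F "\<lambda>\<alpha> v. v"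
    by standard (auto simp: defs)
  interpret j: linear_transformation \<A> "constant_functor :: ('i, 'k, 'k) vfunctor" ?F
    "\<lambda>\<alpha>. Poly_Mapping.single (restrict e \<alpha>)"
    by standard (auto simp: defs base Int_absorb1)
  interpret p: linear_transformation \<A> ?F ?R "\<lambda>\<alpha> v. v - Poly_Mapping.single (restrict e \<alpha>) (coord_sum v)"
  proof standard
    show "v - Poly_Mapping.single (restrict e \<alpha>) (coord_sum v) \<in> obj ?R \<alpha>"
      if "\<alpha> \<in> \<A>" "v \<in> obj ?F \<alpha>" for v \<alpha>
      using that base by (simp add: defs keys_diff_subset)
  qed (auto simp: defs Int_absorb1)
  interpret q: linear_transformation \<A> ?F "constant_functor :: ('i, 'k, 'k) vfunctor" "\<lambda>\<alpha> v. coord_sum v"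
    by standard (auto simp: defs)
  show ?thesis
    by standard (auto simp: defs)
qed

section \<open>Naturality in the product functor\<close>

lemma linear_transformation_push:
  fixes E E' :: "'i \<Rightarrow> 'e set"
  assumes "pointed_morphism \<A> E e E' e' f"
  shows "linear_transformation \<A> (free_functor E :: ('i, 'k::field, ('i \<Rightarrow> 'e) \<Rightarrow>\<^sub>0 'k) vfunctor)
      (free_functor E') (\<lambda>\<alpha>. push (f \<alpha>))"
    and "linear_transformation \<A> (restricted_free_functor E :: ('i, 'k, ('i \<Rightarrow> 'e) \<Rightarrow>\<^sub>0 'k) vfunctor)
      (restricted_free_functor E') (\<lambda>\<alpha>. push (f \<alpha>))"
proof -
  have in_PiE: "Poly_Mapping.keys (push (f \<alpha>) v) \<subseteq> Pi\<^sub>E \<alpha> E'"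
    if "\<alpha> \<in> \<A>" "Poly_Mapping.keys v \<subseteq> Pi\<^sub>E \<alpha> E" for \<alpha> and v :: "('i \<Rightarrow> 'e) \<Rightarrow>\<^sub>0 'k"
  proof -
    have "\<forall>x\<in>Pi\<^sub>E \<alpha> E. f \<alpha> x \<in> Pi\<^sub>E \<alpha> E'"
      using assms that(1) by (simp add: pointed_morphism_def)
    then have "f \<alpha> ` Poly_Mapping.keys v \<subseteq> Pi\<^sub>E \<alpha> E'"
      using that(2) unfolding image_subset_iff by (meson subsetD)
    with keys_push show ?thesis by (rule order_trans)
  qed
  have nat: "push (\<lambda>x. restrict x \<beta>) (push (f \<alpha>) v) = push (f \<beta>) (push (\<lambda>x. restrict x \<beta>) v)"
    if "\<alpha> \<in> \<A>" "\<beta> \<in> \<A>" "\<beta> \<subseteq> \<alpha>" "Poly_Mapping.keys v \<subseteq> Pi\<^sub>E \<alpha> E" for \<alpha> \<beta> and v :: "('i \<Rightarrow> 'e) \<Rightarrow>\<^sub>0 'k"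
    unfolding push_push
  proof (rule push_cong)
    fix x assume "x \<in> Poly_Mapping.keys v"
    then have "x \<in> Pi\<^sub>E \<alpha> E" using that(4) by (rule subsetD[rotated])
    then show "restrict (f \<alpha> x) \<beta> = f \<beta> (restrict x \<beta>)"
      using assms that(1-3) by (simp add: pointed_morphism_def)
  qed
  show "linear_transformation \<A> (free_functor E :: ('i, 'k, ('i \<Rightarrow> 'e) \<Rightarrow>\<^sub>0 'k) vfunctor)
      (free_functor E') (\<lambda>\<alpha>. push (f \<alpha>))"
    by (intro linear_transformation.intro linear_transformation_axioms.intro linear_functor_free additive_push)
      (simp_all add: free_functor_simps push_scale in_PiE nat)
  show "linear_transformation \<A> (restricted_free_functor E :: ('i, 'k, ('i \<Rightarrow> 'e) \<Rightarrow>\<^sub>0 'k) vfunctor)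
      (restricted_free_functor E') (\<lambda>\<alpha>. push (f \<alpha>))"
    by (intro linear_transformation.intro linear_transformation_axioms.intro linear_functor_restricted
        additive_push)
      (simp_all add: free_functor_simps push_scale in_PiE nat coord_sum_push)
qed

text \<open>Outside its locale \<open>sum_map\<close> takes only the hypergraph, the target functor
  and the two injections; the base point enters through the second injection.\<close>

definition free_iso :: "'i set set \<Rightarrow> ('i \<Rightarrow> 'e set) \<Rightarrow> ('i \<Rightarrow> 'e) \<Rightarrow> nat \<Rightarrow> _ \<times> _ \<Rightarrow>
    ('i set, 'i set \<Rightarrow> (('i \<Rightarrow> 'e) \<Rightarrow>\<^sub>0 'k::field)) cech_class" where
  "free_iso \<A> E e = functor_splitting.sum_map \<A> (free_functor E) (\<lambda>\<alpha> v. v)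
     (\<lambda>\<alpha>. Poly_Mapping.single (restrict e \<alpha>))"

lemma free_iso_natural:
  fixes E E' :: "'i \<Rightarrow> 'e set"
  assumes "hypergraph I \<A>" "e \<in> Pi\<^sub>E I E" "e' \<in> Pi\<^sub>E I E'" and f: "pointed_morphism \<A> E e E' e' f"
    and a: "a \<in> vcarrier (cohom \<A> (restricted_free_functor E :: ('i, 'k::field, ('i \<Rightarrow> 'e) \<Rightarrow>\<^sub>0 'k) vfunctor) n)"
    and b: "b \<in> vcarrier (cohom \<A> (constant_functor :: ('i, 'k, 'k) vfunctor) n)"
  shows "free_iso \<A> E' e' n (cohom_map \<A> (restricted_free_functor E') n (\<lambda>\<alpha>. push (f \<alpha>)) a, b) =
    cohom_map \<A> (free_functor E') n (\<lambda>\<alpha>. push (f \<alpha>)) (free_iso \<A> E e n (a, b))"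
proof -
  let ?F = "free_functor E :: ('i, 'k, ('i \<Rightarrow> 'e) \<Rightarrow>\<^sub>0 'k) vfunctor"
  let ?F' = "free_functor E' :: ('i, 'k, ('i \<Rightarrow> 'e) \<Rightarrow>\<^sub>0 'k) vfunctor"
  let ?R = "restricted_free_functor E :: ('i, 'k, ('i \<Rightarrow> 'e) \<Rightarrow>\<^sub>0 'k) vfunctor"
  let ?R' = "restricted_free_functor E' :: ('i, 'k, ('i \<Rightarrow> 'e) \<Rightarrow>\<^sub>0 'k) vfunctor"
  let ?p = "\<lambda>e \<alpha> v. v - Poly_Mapping.single (restrict e \<alpha>) (coord_sum v)"
  interpret S: functor_splitting \<A> ?R "constant_functor :: ('i, 'k, 'k) vfunctor" ?F
    "\<lambda>\<alpha> v. v" "\<lambda>\<alpha>. Poly_Mapping.single (restrict e \<alpha>)" "?p e" "\<lambda>\<alpha> v. coord_sum v"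
    by (rule free_splitting[OF assms(1,2)])
  interpret S': functor_splitting \<A> ?R' "constant_functor :: ('i, 'k, 'k) vfunctor" ?F'
    "\<lambda>\<alpha> v. v" "\<lambda>\<alpha>. Poly_Mapping.single (restrict e' \<alpha>)" "?p e'" "\<lambda>\<alpha> v. coord_sum v"
    by (rule free_splitting[OF assms(1,3)])
  interpret fF: linear_transformation \<A> ?F ?F' "\<lambda>\<alpha>. push (f \<alpha>)" by (rule linear_transformation_push(1)[OF f])
  interpret fR: linear_transformation \<A> ?R ?R' "\<lambda>\<alpha>. push (f \<alpha>)" by (rule linear_transformation_push(2)[OF f])
  obtain c where c: "c \<in> S.i.G.cocyc n" "a = S.i.G.cohom_class n c" using a by (auto simp: S.i.G.cohom_carrier)
  obtain d where d: "d \<in> S.j.G.cocyc n" "b = S.j.G.cohom_class n d" using b by (auto simp: S.j.G.cohom_carrier)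
  \<comment> \<open>Naturality holds already for cocycles of the minimal covering: the inclusions
    commute with \<open>push\<close>, and the base vectors correspond because \<open>f\<close> is
    pointed.\<close>
  have "S'.i.app (fR.app c) + S'.j.app d = fF.app (S.i.app c + S.j.app d)"
  proof (intro ext)
    fix s \<omega>
    have "Poly_Mapping.single (restrict e' \<omega>) (d s \<omega>) = push (f \<omega>) (Poly_Mapping.single (restrict e \<omega>) (d s \<omega>))"
    \<comment> \<open>A pointed morphism is constrained at edges only; away from the simplices at
      \<omega> both sides are 0 because \<open>d s \<omega>\<close> is.\<close>
    proof (cases "s \<in> simplices_at (minimal_cover \<A>) n \<omega>")
      case True
      then have "\<omega> \<in> \<A>" using simplices_at_vertex open_covering_minimal_cover by blast
      then show ?thesis using f by (simp add: push_single pointed_morphism_def)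
    next
      case False
      then have "d s \<omega> = 0" using d(1) cochain_vanish by (fastforce simp: cocycles_def)
      then show ?thesis by (simp add: additive.zero[OF additive_push])
    qed
    then show "(S'.i.app (fR.app c) + S'.j.app d) s \<omega> = fF.app (S.i.app c + S.j.app d) s \<omega>"
      by (simp add: S'.i.app_def S'.j.app_def S.i.app_def S.j.app_def fR.app_def fF.app_def
          additive.add[OF additive_push])
  qed
  then show ?thesis
    using c(1) d(1)
    by (simp add: free_iso_def c(2) d(2) S.sum_map_class S'.sum_map_class fR.cohom_map_class fR.app_cocyc
        fF.cohom_map_class S.i.G'.cocyc_add S.i.app_cocyc S.j.app_cocyc)
qed

text \<open>Choosing \<open>\<Phi>\<close> before \<open>E\<close> and \<open>e\<close> makes it one
  uniform family, for which naturality has a meaning. The clauses beside linearity make it a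
  splitting of the canonical maps given by the inclusion and the coordinate sum; those maps do not
  involve \<open>e\<close>, only the splitting does.\<close>

theorem theorem5p10:
  fixes I :: "'i set" and \<A> :: "'i set set"
  assumes "hypergraph I \<A>"
    and "weak_intersection_property \<A>"
    and "upper_finitely_covered \<A>"
  shows
    "(\<forall>E :: 'i \<Rightarrow> 'e set. product_functor I E \<longrightarrow>
        (\<forall>n>0. vcarrier (cohom \<A>
                  (restricted_free_functor E :: ('i, 'k::field, ('i \<Rightarrow> 'e) \<Rightarrow>\<^sub>0 'k) vfunctor) n) =
               {vzero (cohom \<A> (restricted_free_functor E) n)})) \<and>
     (\<exists>\<Phi>.
        (\<forall>(E :: 'i \<Rightarrow> 'e set) e n. product_functor I E \<longrightarrow> e \<in> Pi\<^sub>E I E \<longrightarrow>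
           linear_iso (\<Phi> E e n)
             (direct_sum (cohom \<A> (restricted_free_functor E) n)
                         (cohom \<A> (constant_functor :: ('i, 'k, 'k) vfunctor) n))
             (cohom \<A> (free_functor E) n) \<and>
           (\<forall>a\<in>vcarrier (cohom \<A> (restricted_free_functor E) n).
              \<Phi> E e n (a, vzero (cohom \<A> constant_functor n)) =
              cohom_map \<A> (free_functor E) n (\<lambda>\<alpha> v. v) a) \<and>
           (\<forall>a\<in>vcarrier (cohom \<A> (restricted_free_functor E) n).
            \<forall>b\<in>vcarrier (cohom \<A> constant_functor n).
              cohom_map \<A> constant_functor n (\<lambda>\<alpha> v. coord_sum v) (\<Phi> E e n (a, b)) = b)) \<and>
        (\<forall>E e E' e' f n. product_functor I E \<longrightarrow> product_functor I E' \<longrightarrow>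
           e \<in> Pi\<^sub>E I E \<longrightarrow> e' \<in> Pi\<^sub>E I E' \<longrightarrow> pointed_morphism \<A> E e E' e' f \<longrightarrow>
           (\<forall>a\<in>vcarrier (cohom \<A> (restricted_free_functor E) n).
            \<forall>b\<in>vcarrier (cohom \<A> constant_functor n).
              \<Phi> E' e' n (cohom_map \<A> (restricted_free_functor E') n (\<lambda>\<alpha>. push (f \<alpha>)) a, b) =
              cohom_map \<A> (free_functor E') n (\<lambda>\<alpha>. push (f \<alpha>)) (\<Phi> E e n (a, b)))))"
  using cohom_restricted_vanishes[OF assms(1,2)] free_iso_natural[OF assms(1)]
    functor_splitting.sum_map_linear_iso[OF free_splitting[OF assms(1)]]
    functor_splitting.sum_map_left[OF free_splitting[OF assms(1)]]
    functor_splitting.sum_map_right[OF free_splitting[OF assms(1)]]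
  by (intro conjI exI[of _ "free_iso \<A>"] allI impI ballI) (simp_all add: free_iso_def)

end
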